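(* Let $a,b$ be numbers, and define $\mu_n(a,b,q)$ for $n\ge0$ by \[ \sum_{n\ge0}\mu_n(a,b,q)z^n=\cfrac{1}{1-\cfrac{\lambda_1z}{1-\cfrac{\lambda_2z}{1-\cdots}}},\qquad \lambda_n=\begin{cases}[nb+a]_q[nb-a]_q & n\text{ odd},\\ [nb]_q^2 & n\text{ even}.\end{cases} \] Then \[ \mu_n(a,b,q)=\frac{1}{(1-q)^{2n}}\sum_{k=0}^{n}\left(\binom{2n}{n-k}-\binom{2n}{n-k-1}\right)\sum_{j=-k}^{k}(-1)^jq^{aj+b(k(k+1)-j^2)}, \] and, writing $\mu_n(a,b,1)$ for the value at $q=1$ (where $[x]_1=x$), \[ \sum_{n\ge0}\mu_n(a,b,1)\frac{z^{2n}}{(2n)!}=\frac{\cos(az)}{\cos(bz)}. \] Moreover, $\mu_n(a,b,q)$ is a polynomial in $q$ with nonnegative coefficients whenever $a,b$ are integers with $0\le a<b$, or $a,b$ are both half-integers (elements of $\tfrac12+\mathbb Z$) with $0\le a<b$.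
   Context: For any number $x$, $[x]_q=(1-q^x)/(1-q)$. The continued fraction is a formal power series in $z$ (limit of its finite truncations). Binomial coefficients with negative lower index are $0$. *)

theory Defs
  imports "HOL-Analysis.Analysis" "HOL-Computational_Algebra.Formal_Power_Series"
begin

text \<open>
  For complex \<open>q \<noteq> 0\<close> the power \<open>q\<^sup>x\<close> is the principal one, \<open>exp (x * Ln q)\<close>; at \<open>q = 1\<close> the
  quotient is completed by its limit \<open>x\<close>. The value at \<open>q = 0\<close> is a dummy, because \<open>0 powr 0 = 0\<close>.
\<close>
definition qnum :: "complex \<Rightarrow> complex \<Rightarrow> complex" where
  "qnum q x = (if q = 1 then x else (1 - q powr x) / (1 - q))"

text \<open>
  \<open>sfrac_trunc l i N\<close> is \<open>1 / (1 - l i z / (1 - l (i+1) z / (\<dots> / (1 - l (i+N-1) z))))\<close>.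
\<close>
fun sfrac_trunc :: "(nat \<Rightarrow> 'a::field) \<Rightarrow> nat \<Rightarrow> nat \<Rightarrow> 'a fps" where
  "sfrac_trunc l i 0 = 1"
| "sfrac_trunc l i (Suc N) = 1 / (1 - fps_const (l i) * fps_X * sfrac_trunc l (Suc i) N)"

definition sfrac :: "(nat \<Rightarrow> 'a::field) \<Rightarrow> 'a fps" where
  "sfrac l = lim (\<lambda>N. sfrac_trunc l 1 N)"

definition lam :: "complex \<Rightarrow> complex \<Rightarrow> complex \<Rightarrow> nat \<Rightarrow> complex" where
  "lam a b q n =
     (if odd n then qnum q (of_nat n * b + a) * qnum q (of_nat n * b - a)
      else (qnum q (of_nat n * b))\<^sup>2)"

definition mu :: "nat \<Rightarrow> complex \<Rightarrow> complex \<Rightarrow> complex \<Rightarrow> complex" where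
  "mu n a b q = fps_nth (sfrac (lam a b q)) n"

definition binom :: "nat \<Rightarrow> int \<Rightarrow> int" where
  "binom n k = (if k < 0 then 0 else int (n choose nat k))"

text \<open>The truncations converge, so the \<open>lim\<close> in the definition of \<open>sfrac\<close> is a genuine limit.\<close>

lemma sfrac_trunc_Suc_nth:
  "n \<le> N \<Longrightarrow> fps_nth (sfrac_trunc l i (Suc N)) n = fps_nth (sfrac_trunc l i N) n"
proof (induction N arbitrary: i n)
  case 0
  then show ?case by simp
next
  case (Suc N)
  define A where "A = sfrac_trunc l (Suc i) (Suc N)"
  define B where "B = sfrac_trunc l (Suc i) N"
  define c where "c = fps_const (l i)"
  define f where "f = 1 / (1 - c * fps_X * A)"
  define g where "g = 1 / (1 - c * fps_X * B)"
  have f: "f * (1 - c * fps_X * A) = 1" and g: "g * (1 - c * fps_X * B) = 1"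
    unfolding f_def g_def by (simp_all add: fps_divide_unit inverse_mult_eq_1)
  have "f - g = f * (g * (1 - c * fps_X * B)) - g * (f * (1 - c * fps_X * A))"
    by (simp only: f g mult_1_right)
  also have "\<dots> = (f * g * c) * (fps_X * (A - B))"
    by (simp add: algebra_simps)
  finally have eq: "f - g = (f * g * c) * (fps_X * (A - B))" .
  have AB: "fps_nth A k = fps_nth B k" if "k \<le> N" for k
    unfolding A_def B_def using that by (rule Suc.IH)
  have XAB: "fps_nth (fps_X * (A - B)) k = 0" if "k \<le> Suc N" for k
    using that AB[of "k - 1"] by (cases k) auto
  have "fps_nth (f - g) n = 0"
    unfolding eq fps_mult_nth[of "f * g * c"]
  proof (intro sum.neutral ballI)
    fix k
    have "fps_nth (fps_X * (A - B)) (n - k) = 0"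
      using Suc.prems by (intro XAB) simp
    then show "fps_nth (f * g * c) k * fps_nth (fps_X * (A - B)) (n - k) = 0"
      by (simp only: mult_zero_right)
  qed
  moreover have "sfrac_trunc l i (Suc (Suc N)) = f" "sfrac_trunc l i (Suc N) = g"
    unfolding f_def g_def A_def B_def c_def by (rule sfrac_trunc.simps(2))+
  ultimately show ?case by simp
qed

lemma sfrac_trunc_nth:
  assumes "n \<le> N"
  shows "fps_nth (sfrac_trunc l i N) n = fps_nth (sfrac_trunc l i n) n"
  using assms
  by (induction N rule: dec_induct) (simp_all add: sfrac_trunc_Suc_nth del: sfrac_trunc.simps)

lemma sfrac_trunc_tendsto:
  "sfrac_trunc l 1 \<longlonglongrightarrow> Abs_fps (\<lambda>n. fps_nth (sfrac_trunc l 1 n) n)"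
proof (rule tendsto_fpsI)
  fix n
  show "\<forall>\<^sub>F N in sequentially. fps_nth (sfrac_trunc l 1 N) n
          = fps_nth (Abs_fps (\<lambda>n. fps_nth (sfrac_trunc l 1 n) n)) n"
    using eventually_ge_at_top[of n]
    by eventually_elim (simp only: fps_nth_Abs_fps, rule sfrac_trunc_nth)
qed

lemma sfrac_trunc_LIMSEQ: "sfrac_trunc l 1 \<longlonglongrightarrow> sfrac l"
  using limI[OF sfrac_trunc_tendsto] sfrac_trunc_tendsto unfolding sfrac_def by metis

lemma sfrac_nth: "fps_nth (sfrac l) n = fps_nth (sfrac_trunc l 1 n) n"
  using LIMSEQ_unique[OF sfrac_trunc_LIMSEQ sfrac_trunc_tendsto, of l] by simp

end

theory Submission
  imports Defs
begin

text \<open>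
  Let \<open>L\<close> be the functional on polynomials in \<open>y = x\<^sup>2\<close> with \<open>L (y ^ n)\<close> the \<open>n\<close>-th moment of the
  continued fraction. Put \<open>A = q\<^sup>a\<close>, \<open>B = q\<^sup>b\<close>, rescale by \<open>(1 - q)\<^sup>2\<close>, and let
  \<open>\<phi> k = (\<Prod>i<k. (1 - B\<^bsup>2i\<^esup>)\<^sup>2 + B\<^bsup>2i\<^esup> y)\<close>; with \<open>x = t\<^bsup>1/2\<^esup> + t\<^bsup>-1/2\<^esup>\<close> its factors are
  \<open>(1 + B\<^bsup>2i\<^esup> t) (1 + B\<^bsup>2i\<^esup> / t)\<close>. Expanding \<open>\<phi> k\<close> in the orthogonal polynomials (continuous dual
  \<open>q\<close>-Hahn) has coefficients in product form, and gives \<open>L (\<phi> k) = \<lambda>\<^sub>1 \<lambda>\<^sub>3 \<dots> \<lambda>\<^bsub>2k-1\<^esub>\<close>. The claimed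
  formula says that \<open>L\<close> sends the Chebyshev polynomial \<open>U\<^bsub>2k\<^esub>(x)\<close> to the inner theta sum; expanding
  \<open>\<phi> k\<close> in these polynomials instead and summing by parts, it takes the same values on \<open>\<phi> k\<close> by the finite
  Jacobi triple product. Since the \<open>\<phi> k\<close> form a basis, both functionals agree.

  At \<open>q = 1\<close> the same basis becomes \<open>\<phi> k = (\<Prod>i<k. y + 4 b\<^sup>2 i\<^sup>2)\<close>. The exponential generating
  function is then a power series in \<open>sin (b z) / b\<close> with coefficients \<open>L (\<phi> k) / (2k)!\<close>, and its product
  with \<open>cos (b z)\<close> solves \<open>Z'' = - a\<^sup>2 Z\<close>.
\<close>

section \<open>Moments of a Stieltjes fraction\<close>

text \<open>
  Two steps of a Dyck path weighted by \<open>l\<close> on its down-steps, seen at even heights \<open>2 * h\<close>: this is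
  multiplication by \<open>y\<close> in the basis of the even orthogonal polynomials. The weight \<open>l 0\<close> is meant
  to be \<open>0\<close>.
\<close>
definition jac_step :: "(nat \<Rightarrow> 'a::field) \<Rightarrow> (nat \<Rightarrow> 'a) \<Rightarrow> nat \<Rightarrow> 'a" where
  "jac_step l w h =
     (if h = 0 then 0 else w (h - 1)) + (l (2 * h) + l (2 * h + 1)) * w h
       + l (2 * h + 1) * l (2 * h + 2) * w (h + 1)"

definition unit0 :: "nat \<Rightarrow> 'a::zero_neq_one" where
  "unit0 h = (if h = 0 then 1 else 0)"

lemma jac_step_linear:
  "jac_step l (\<lambda>h. c * u h + d * v h) = (\<lambda>h. c * jac_step l u h + d * jac_step l v h)"
  by (rule ext) (simp add: jac_step_def algebra_simps)

lemma jac_step_iter_linear: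
  "(jac_step l ^^ n) (\<lambda>h. c * u h + d * v h)
     = (\<lambda>h. c * (jac_step l ^^ n) u h + d * (jac_step l ^^ n) v h)"
  by (induction n) (simp_all add: jac_step_linear)

text \<open>A path of \<open>n\<close> double steps ending at height \<open>2 * h\<close> has
  \<open>n - h\<close> down-steps, each contributing one factor \<open>c\<close>. Multiplying by
  \<open>c ^ h\<close> avoids a difference in the exponent.\<close>

lemma jac_step_iter_scale:
  "(jac_step (\<lambda>m. c * l m) ^^ n) unit0 h * c ^ h = c ^ n * (jac_step l ^^ n) unit0 h"
proof (induction n arbitrary: h)
  case 0
  show ?case by (simp add: unit0_def)
next
  case (Suc n)
  define w where "w = (jac_step (\<lambda>m. c * l m) ^^ n) unit0"
  define u where "u = (jac_step l ^^ n) unit0"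
  have IH: "w h * c ^ h = c ^ n * u h" for h
    unfolding w_def u_def by (rule Suc.IH)
  have "jac_step (\<lambda>m. c * l m) w h * c ^ h = c ^ Suc n * jac_step l u h"
  proof (cases h)
    case 0
    have "w 0 = c ^ n * u 0" "w 1 * c = c ^ n * u 1"
      using IH[of 0] IH[of 1] by simp_all
    moreover have "jac_step (\<lambda>m. c * l m) w 0 = c * (l 0 + l 1) * w 0 + c * l 1 * l 2 * (w 1 * c)"
      by (simp add: jac_step_def algebra_simps eval_nat_numeral)
    ultimately show ?thesis
      using 0 by (simp add: jac_step_def algebra_simps eval_nat_numeral)
  next
    case (Suc i)
    have "jac_step (\<lambda>m. c * l m) w h * c ^ h
        = c * (w i * c ^ i) + c * (l (2 * h) + l (2 * h + 1)) * (w h * c ^ h)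
          + c * l (2 * h + 1) * l (2 * h + 2) * (w (h + 1) * c ^ (h + 1))"
      using Suc by (simp add: jac_step_def algebra_simps)
    also have "\<dots> = c ^ Suc n * jac_step l u h"
      unfolding IH using Suc by (simp add: jac_step_def algebra_simps)
    finally show ?thesis .
  qed
  then show ?case by (simp add: w_def u_def)
qed

section \<open>Tails of the fraction and weighted Dyck paths\<close>

definition sfrac_tail :: "(nat \<Rightarrow> 'a::field) \<Rightarrow> nat \<Rightarrow> 'a fps" where
  "sfrac_tail l i = Abs_fps (\<lambda>n. fps_nth (sfrac_trunc l i n) n)"

lemma sfrac_tail_nth: "n \<le> N \<Longrightarrow> fps_nth (sfrac_tail l i) n = fps_nth (sfrac_trunc l i N) n"
  unfolding sfrac_tail_def fps_nth_Abs_fps by (rule sfrac_trunc_nth[symmetric])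

text \<open>The relation f_i = 1 / (1 - l_i z f_(i+1)), cleared of its denominator. It is exact for
  truncations, and the factor z makes depth \<open>n\<close> of the inner tail enough for
  coefficient \<open>n\<close>.\<close>

lemma sfrac_tail_rec:
  "sfrac_tail l i = 1 + fps_const (l i) * fps_X * sfrac_tail l i * sfrac_tail l (Suc i)"
proof (rule fps_ext)
  fix n
  define f where "f = sfrac_trunc l i (Suc n)"
  define g where "g = sfrac_trunc l (Suc i) n"
  have unit: "f * (1 - fps_const (l i) * fps_X * g) = 1"
    unfolding f_def g_def by (simp add: fps_divide_unit inverse_mult_eq_1)
  have "f = f * (1 - fps_const (l i) * fps_X * g) + fps_const (l i) * (fps_X * (f * g))"
    by (simp add: algebra_simps)
  then have f: "f = 1 + fps_const (l i) * (fps_X * (f * g))"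
    unfolding unit .
  have nth: "fps_nth (sfrac_tail l i) m = fps_nth f m"
    "fps_nth (sfrac_tail l (Suc i)) m = fps_nth g m" if "m \<le> n" for m
    unfolding f_def g_def using that by (intro sfrac_tail_nth; simp)+
  have "fps_nth (sfrac_tail l i * sfrac_tail l (Suc i)) m = fps_nth (f * g) m" if "m \<le> n" for m
    unfolding fps_mult_nth using that nth by (intro sum.cong) auto
  then have "fps_nth (fps_X * (sfrac_tail l i * sfrac_tail l (Suc i))) n = fps_nth (fps_X * (f * g)) n"
    by (cases n) simp_all
  moreover have "fps_nth f n = fps_nth (1 + fps_const (l i) * (fps_X * (f * g))) n"
    using f by (rule arg_cong)
  ultimately show "fps_nth (sfrac_tail l i) n
      = fps_nth (1 + fps_const (l i) * fps_X * sfrac_tail l i * sfrac_tail l (Suc i)) n"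
    unfolding nth(1)[OF order_refl] mult.assoc by (simp only: fps_add_nth fps_mult_left_const_nth)
qed

text \<open>Taking the steps of a path in pairs turns the S-fraction into a J-fraction. The
  hypothesis removes the double step that would dip below height 0.\<close>

lemma sfrac_nth_eq_jac_step:
  fixes l :: "nat \<Rightarrow> 'a::field"
  assumes "l 0 = 0"
  shows "fps_nth (sfrac l) n = (jac_step l ^^ n) unit0 0"
proof -
  \<comment> \<open>\<open>W (h + 1)\<close> generates the weighted paths from height \<open>0\<close> to height \<open>h\<close>.\<close>
  define W where "W h = (\<Prod>i<h. sfrac_tail l (Suc i))" for h
  define c where "c m = fps_const (l m)" for m
  \<comment> \<open>A path to height 2h with d down-steps has 2(h + d) steps, so this power makes z
    count double steps.\<close>
  define Y where "Y h = fps_X ^ h * W (2 * h + 1)" for h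
  \<comment> \<open>Last-step decomposition, with z marking down-steps: a path ending at height
    \<open>h\<close> arrives from \<open>h - 1\<close>, or from \<open>h + 1\<close> with weight
    \<open>l (h + 1)\<close>. For \<open>h = 0\<close> the term \<open>W 0 = 1\<close> is the empty
    path.\<close>
  have W_rec: "W (Suc h) = W h + c (Suc h) * fps_X * W (Suc (Suc h))" for h
  proof -
    have "W (Suc h) = W h * sfrac_tail l (Suc h)" by (simp add: W_def)
    also have "\<dots> = W h + c (Suc h) * fps_X * W (Suc (Suc h))"
      by (subst sfrac_tail_rec) (simp add: W_def c_def algebra_simps)
    finally show ?thesis .
  qed
  have Y_Suc: "Y (Suc h) = fps_X * (Y h + (c (2 * Suc h) + c (2 * Suc h + 1)) * Y (Suc h)
       + c (2 * Suc h + 1) * c (2 * Suc h + 2) * Y (Suc (Suc h)))" for h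
  proof -
    have 1: "W (2 * h + 3) = W (2 * h + 2) + c (2 * h + 3) * fps_X * W (2 * h + 4)"
      using W_rec[of "2 * h + 2"] by (simp add: eval_nat_numeral)
    have 2: "W (2 * h + 2) = W (2 * h + 1) + c (2 * h + 2) * fps_X * W (2 * h + 3)"
      using W_rec[of "2 * h + 1"] by (simp add: eval_nat_numeral)
    have 3: "W (2 * h + 4) = W (2 * h + 3) + c (2 * h + 4) * fps_X * W (2 * h + 5)"
      using W_rec[of "2 * h + 3"] by (simp add: eval_nat_numeral)
    have "W (2 * h + 3) = W (2 * h + 1) + fps_X * (c (2 * h + 2) + c (2 * h + 3)) * W (2 * h + 3)
        + fps_X\<^sup>2 * c (2 * h + 3) * c (2 * h + 4) * W (2 * h + 5)"
      by (subst 1, subst 2, subst 3) (simp add: algebra_simps power2_eq_square)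
    then have "fps_X ^ Suc h * W (2 * h + 3) = fps_X ^ Suc h * (W (2 * h + 1) + fps_X * (c (2 * h + 2) + c (2 * h + 3)) * W (2 * h + 3)
        + fps_X\<^sup>2 * c (2 * h + 3) * c (2 * h + 4) * W (2 * h + 5))"
      by simp
    also have "\<dots> = fps_X * (Y h + (c (2 * h + 2) + c (2 * h + 3)) * (fps_X ^ Suc h * W (2 * h + 3))
       + c (2 * h + 3) * c (2 * h + 4) * (fps_X ^ Suc (Suc h) * W (2 * h + 5)))"
      unfolding Y_def by (simp add: algebra_simps power2_eq_square)
    finally show ?thesis
      by (simp only: Y_def mult_Suc_right add.assoc) (simp add: eval_nat_numeral)
  qed
  have Y_0: "Y 0 = 1 + fps_X * ((c 0 + c 1) * Y 0
       + c 1 * c 2 * Y 1)"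
  proof -
    have 1: "W 1 = 1 + c 1 * fps_X * W 2"
      using W_rec[of 0] by (simp add: W_def eval_nat_numeral)
    have 2: "W 2 = W 1 + c 2 * fps_X * W 3"
      using W_rec[of 1] by (simp add: eval_nat_numeral)
    have "W 1 = 1 + fps_X * (c 1 * W 1 + c 1 * c 2 * (fps_X * W 3))"
      by (subst 1, subst 2) (simp add: algebra_simps)
    then show ?thesis
      using assms by (simp add: Y_def c_def)
  qed
  have "fps_nth (Y h) n = (jac_step l ^^ n) unit0 h" for h
  proof (induction n arbitrary: h)
    case 0
    have "fps_nth (Y 0) 0 = 1" by (subst Y_0) (simp add: c_def)
    moreover have "fps_nth (Y (Suc h)) 0 = 0" for h by (simp add: Y_def)
    ultimately show ?case by (cases h) (simp_all add: unit0_def)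
  next
    case (Suc n)
    have "fps_nth (Y h) (Suc n) = jac_step l (\<lambda>h. fps_nth (Y h) n) h"
    proof (cases h)
      case 0
      then show ?thesis
        by (simp only: 0, subst Y_0) (simp add: c_def jac_step_def algebra_simps eval_nat_numeral)
    next
      case (Suc i)
      then show ?thesis
        by (simp only: Suc, subst Y_Suc) (simp add: c_def jac_step_def algebra_simps)
    qed
    then show ?case using Suc.IH by simp
  qed
  moreover have "Y 0 = sfrac_tail l 1" by (simp add: Y_def W_def)
  ultimately have "fps_nth (sfrac_tail l 1) n = (jac_step l ^^ n) unit0 0"
    by metis
  then show ?thesis
    by (simp only: sfrac_nth sfrac_tail_def fps_nth_Abs_fps)
qed

text \<open>Transports the recurrence of the basis, from \<phi> k to y^n \<phi> k; this is the form
  that \<open>double_index_unique\<close> asks for.\<close>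

lemma jac_step_iter_comb:
  assumes "\<And>k h. D (Suc k) h = e k * D k h + r k * jac_step l (D k) h"
  shows "(jac_step l ^^ n) (D (Suc k)) h
      = e k * (jac_step l ^^ n) (D k) h + r k * (jac_step l ^^ Suc n) (D k) h"
proof -
  have "D (Suc k) = (\<lambda>h. e k * D k h + r k * jac_step l (D k) h)"
    using assms by auto
  then show ?thesis
    by (simp only: jac_step_iter_linear funpow_Suc_right o_apply)
qed

text \<open>
  With \<open>M n k = L (y ^ n * \<phi> k)\<close> this says that a functional \<open>L\<close> is determined by its values on
  a basis \<open>\<phi> (k + 1) = (e k + r k * y) * \<phi> k\<close>.
\<close>
lemma double_index_unique:
  fixes M M' :: "nat \<Rightarrow> nat \<Rightarrow> 'a::field"
  assumes "\<And>n k. M n (Suc k) = e k * M n k + r k * M (Suc n) k"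
    and "\<And>n k. M' n (Suc k) = e k * M' n k + r k * M' (Suc n) k"
    and "\<And>k. r k \<noteq> 0"
    and "\<And>k. k \<le> N \<Longrightarrow> M 0 k = M' 0 k"
    and "n + k \<le> N"
  shows "M n k = M' n k"
  using assms(5)
proof (induction n arbitrary: k)
  case 0
  then show ?case using assms(4) by simp
next
  case (Suc n)
  have "M n (Suc k) = M' n (Suc k)" "M n k = M' n k"
    using Suc.prems by (intro Suc.IH; simp)+
  then have "r k * M (Suc n) k = r k * M' (Suc n) k"
    using assms(1)[of n k] assms(2)[of n k] by simp
  then show ?case using assms(3) by simp
qed

text \<open>Here \<open>D k h\<close> is the coefficient of the \<open>h\<close>-th even orthogonal polynomial in \<open>\<phi> k\<close>.\<close>
lemma jac_step_product_form:
  fixes l :: "nat \<Rightarrow> 'a::field"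
  assumes rec0: "\<And>k. K (Suc k) 0 * l (2 * k + 1)
      = K k 0 * (e k + r k * (l 0 + l 1)) + r k * (l 2 * K k 1)"
    and rec: "\<And>k h. h < k \<Longrightarrow> K (Suc k) (Suc h) * l (2 * k + 1)
      = K k (Suc h) * (e k + r k * (l (2 * h + 2) + l (2 * h + 3)))
        + r k * (K k h * l (2 * h + 1) + l (2 * h + 4) * K k (h + 2))"
    and diag: "\<And>k. K (Suc k) (Suc k) = r k * K k k"
    and zero: "\<And>k h. k < h \<Longrightarrow> K k h = 0"
  defines "D \<equiv> \<lambda>k h. K k h * (\<Prod>i=h..<k. l (2 * i + 1))"
  shows "D (Suc k) h = e k * D k h + r k * jac_step l (D k) h"
proof -
  define R where "R k h = (\<Prod>i=h..<k. l (2 * i + 1))" for k h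
  have D: "D k h = K k h * R k h" for k h by (simp add: D_def R_def)
  \<comment> \<open>These facts give all neighbouring terms the common factor \<open>R k h\<close>:
    the down-weight \<open>l (2 * h + 1)\<close> in \<open>jac_step\<close> supplies what
    \<open>R k (Suc h)\<close> lacks, so no weight is divided by.\<close>
  have R1: "R (Suc k) h = R k h * l (2 * k + 1)" if "h \<le> k" for h
    using that by (simp add: R_def)
  have R2: "R k h = l (2 * h + 1) * R k (Suc h)" if "h < k" for h
    using that by (simp add: R_def prod.atLeast_Suc_lessThan)
  have R3: "l (2 * h + 1) * D k (Suc h) = K k (Suc h) * R k h" if "h \<le> k" for h
    using that R2[of h] zero[of k "Suc h"] by (cases "h = k") (auto simp: D)
  show ?thesis
  proof (cases h)
    case 0
    have "jac_step l (D k) 0 = (l 0 + l 1) * D k 0 + l 2 * (l 1 * D k 1)"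
      by (simp add: jac_step_def eval_nat_numeral)
    also have "\<dots> = R k 0 * (K k 0 * (l 0 + l 1) + l 2 * K k 1)"
      using R3[of 0] by (simp add: D[of k 0] algebra_simps)
    finally have J: "jac_step l (D k) 0 = R k 0 * (K k 0 * (l 0 + l 1) + l 2 * K k 1)" .
    have "D (Suc k) 0 = R k 0 * (K (Suc k) 0 * l (2 * k + 1))"
      using R1[of 0] by (simp add: D)
    also have "\<dots> = e k * D k 0 + r k * jac_step l (D k) 0"
      unfolding rec0 J by (simp add: D algebra_simps)
    finally show ?thesis using 0 by simp
  next
    case (Suc i)
    consider "i < k" | "i = k" | "i > k" by linarith
    then show ?thesis
    proof cases
      case 1
      have "jac_step l (D k) h = D k i + (l (2 * i + 2) + l (2 * i + 3)) * D k (Suc i)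
          + l (2 * i + 4) * (l (2 * Suc i + 1) * D k (Suc (Suc i)))"
        using Suc by (simp add: jac_step_def eval_nat_numeral)
      also have "\<dots> = R k (Suc i) * (K k i * l (2 * i + 1) + K k (Suc i) * (l (2 * i + 2) + l (2 * i + 3)) + l (2 * i + 4) * K k (i + 2))"
        using R3[of "Suc i"] R2[of i] 1 by (simp add: D[of k i] D[of k "Suc i"] algebra_simps)
      finally have J: "jac_step l (D k) h = \<dots>" .
      have "D (Suc k) h = R k (Suc i) * (K (Suc k) (Suc i) * l (2 * k + 1))"
        using R1[of "Suc i"] 1 Suc by (simp add: D)
      also have "\<dots> = e k * D k h + r k * jac_step l (D k) h"
        unfolding rec[OF 1] J using Suc by (simp add: D algebra_simps)
      finally show ?thesis .
    next
      case 2
      then show ?thesis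
        using Suc diag[of k] zero[of k] by (simp add: D R_def jac_step_def)
    next
      case 3
      then show ?thesis
        using Suc zero[of k] zero[of "Suc k"] by (simp add: D jac_step_def)
    qed
  qed
qed

section \<open>Gaussian binomial coefficients and the finite Jacobi triple product\<close>

text \<open>
  Defined by Pascal's rule, so that it makes sense when \<open>p\<close> is a root of unity; the lower index is an
  integer, and negative powers of \<open>p\<close> only ever multiply \<open>0\<close>.
\<close>
primrec gbin :: "'a::field \<Rightarrow> nat \<Rightarrow> int \<Rightarrow> 'a" where
  "gbin p 0 m = (if m = 0 then 1 else 0)"
| "gbin p (Suc n) m = gbin p n (m - 1) + p powi m * gbin p n m"

lemma gbin_eq_0: "m < 0 \<or> int n < m \<Longrightarrow> gbin p n m = 0"
  by (induction n arbitrary: m) auto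

lemma gbin_self: "gbin p n (int n) = 1"
  by (induction n) (simp_all add: gbin_eq_0)

text \<open>The quotient of neighbouring Gaussian binomials in cross-multiplied form, which survives
  roots of unity. Later identities are reduced to it.\<close>

lemma gbin_ratio:
  assumes "p \<noteq> 0"
  shows "(1 - p powi (m + 1)) * gbin p n (m + 1) = (1 - p powi (int n - m)) * gbin p n m"
proof (induction n arbitrary: m)
  case 0
  show ?case by auto
next
  case (Suc n)
  define x where "x = p powi m"
  define y where "y = p powi (int n - m)"
  have x: "p powi (m + 1) = p * x" and y: "p powi (int (Suc n) - m) = p * y"
    and y': "p powi (int n - (m - 1)) = p * y"
    using assms by (simp_all add: x_def y_def power_int_add power_int_diff)
  have "(1 - p * x) * gbin p n (m + 1) = (1 - y) * gbin p n m"
    using Suc.IH[of m] x by (simp add: y_def)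
  moreover have "(1 - x) * gbin p n m = (1 - p * y) * gbin p n (m - 1)"
    using Suc.IH[of "m - 1"] y' by (simp add: x_def)
  ultimately have "(1 - p * x) * (gbin p n m + p * x * gbin p n (m + 1))
      = (1 - p * y) * (gbin p n (m - 1) + x * gbin p n m)"
    by algebra
  then show ?case
    unfolding x y by (simp add: x x_def)
qed

lemma gbin_Suc':
  assumes "p \<noteq> 0"
  shows "gbin p (Suc n) m = p powi (int n + 1 - m) * gbin p n (m - 1) + gbin p n m"
  using gbin_ratio[OF assms, of "m - 1" n] by (simp add: algebra_simps)

lemma gbin_sym:
  assumes "p \<noteq> 0"
  shows "gbin p n (int n - m) = gbin p n m"
proof (induction n arbitrary: m)
  case 0
  show ?case by auto
next
  case (Suc n)
  have "gbin p (Suc n) (int (Suc n) - m)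
      = p powi m * gbin p n (int n - m) + gbin p n (int n - (m - 1))"
    by (subst gbin_Suc'[OF assms]) (simp add: algebra_simps)
  then show ?case using Suc.IH by simp
qed

section \<open>Centred Gaussian binomial coefficients\<close>

definition cgbin :: "'a::field \<Rightarrow> nat \<Rightarrow> int \<Rightarrow> 'a" where
  "cgbin B k r = gbin (B\<^sup>2) (2 * k) (int k + r)"

lemma cgbin_eq_0: "int k < \<bar>r\<bar> \<Longrightarrow> cgbin B k r = 0"
  unfolding cgbin_def by (rule gbin_eq_0) auto

lemma cgbin_0: "cgbin B 0 r = (if r = 0 then 1 else 0)"
  by (simp add: cgbin_def)

lemma cgbin_uminus: "B \<noteq> 0 \<Longrightarrow> cgbin B k (- r) = cgbin B k r"
  using gbin_sym[of "B\<^sup>2" "2 * k" "int k + r"] by (simp add: cgbin_def)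

lemma cgbin_ratio:
  assumes "B \<noteq> 0"
  shows "(1 - B powi (2 * (int k + r + 1))) * cgbin B k (r + 1)
      = (1 - B powi (2 * (int k - r))) * cgbin B k r"
  using gbin_ratio[of "B\<^sup>2" "int k + r" "2 * k"] assms
  by (simp add: cgbin_def power_int_power add.assoc)

text \<open>Two Pascal steps lead from \<open>2 * k\<close> to \<open>2 * k + 2\<close>; using one
  rule of each kind makes the result symmetric under r to -r.\<close>

lemma cgbin_Suc:
  assumes "B \<noteq> 0"
  shows "cgbin B (Suc k) r = (1 + B ^ (4 * k + 2)) * cgbin B k r
      + B powi (2 * (int k + 1 - r)) * cgbin B k (r - 1)
      + B powi (2 * (int k + 1 + r)) * cgbin B k (r + 1)"
proof -
  have p: "B\<^sup>2 \<noteq> 0" using assms by simp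
  have pw: "(B\<^sup>2) powi m = B powi (2 * m)" for m by (simp add: power_int_power)
  have "cgbin B (Suc k) r = gbin (B\<^sup>2) (Suc (Suc (2 * k))) (int k + r + 1)"
    by (simp add: cgbin_def algebra_simps)
  also have "\<dots> = gbin (B\<^sup>2) (Suc (2 * k)) (int k + r)
      + B powi (2 * (int k + 1 + r)) * gbin (B\<^sup>2) (Suc (2 * k)) (int k + r + 1)"
    by (subst gbin.simps(2)) (simp add: pw algebra_simps)
  also have "gbin (B\<^sup>2) (Suc (2 * k)) (int k + r)
      = B powi (2 * (int k + 1 - r)) * cgbin B k (r - 1) + cgbin B k r"
    by (subst gbin_Suc'[OF p]) (simp add: pw cgbin_def algebra_simps)
  also have "gbin (B\<^sup>2) (Suc (2 * k)) (int k + r + 1)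
      = B powi (2 * (int k - r)) * cgbin B k r + cgbin B k (r + 1)"
    by (subst gbin_Suc'[OF p]) (simp add: pw cgbin_def algebra_simps)
  also have "B powi (2 * (int k - r)) * B powi (2 * (int k + 1 + r)) = B ^ (4 * k + 2)"
  proof -
    have "B powi (2 * (int k - r)) * B powi (2 * (int k + 1 + r))
        = B powi (2 * (int k - r) + 2 * (int k + 1 + r))"
      using assms by (simp only: power_int_add simp_thms)
    also have "2 * (int k - r) + 2 * (int k + 1 + r) = int (4 * k + 2)" by simp
    finally show ?thesis by (simp only: power_int_of_nat)
  qed
  then have "B powi (2 * (int k + 1 + r)) * (B powi (2 * (int k - r)) * cgbin B k r + cgbin B k (r + 1))
      = B ^ (4 * k + 2) * cgbin B k r + B powi (2 * (int k + 1 + r)) * cgbin B k (r + 1)"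
    by (simp add: algebra_simps flip: mult.assoc)
  finally show ?thesis by (simp add: algebra_simps)
qed

section \<open>The finite Jacobi triple product\<close>

lemma sum_int_shift:
  fixes f :: "int \<Rightarrow> 'a::comm_monoid_add"
  assumes "\<And>j. int N \<le> \<bar>j\<bar> \<Longrightarrow> f j = 0" and "\<bar>d\<bar> \<le> 1"
  shows "(\<Sum>j=-int N..int N. f (j + d)) = (\<Sum>j=-int N..int N. f j)"
proof -
  have "(\<Sum>j=-int N..int N. f (j + d)) = (\<Sum>j=-int N+d..int N+d. f j)"
    by (rule sum.reindex_bij_witness[of _ "\<lambda>j. j - d" "\<lambda>j. j + d"]) auto
  also have "\<dots> = (\<Sum>j=-int N-1..int N+1. f j)"
    using assms by (intro sum.mono_neutral_left) auto
  also have "\<dots> = (\<Sum>j=-int N..int N. f j)"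
    using assms(1) by (intro sum.mono_neutral_right) auto
  finally show ?thesis .
qed

text \<open>Induction on \<open>k\<close> in a fixed window: with b = B^(2k+1), summing the
  recurrence of the summands over j multiplies the sum by 1 + b^2 - b A - b / A = (1 - b A) (1 - b /
  A).\<close>

lemma finite_jacobi_triple:
  fixes A B :: "'a::field"
  assumes "A \<noteq> 0" "B \<noteq> 0" "k \<le> N"
  shows "(\<Sum>j=-int N..int N. (-1) powi j * A powi j * B powi (j * j) * cgbin B k j)
      = (\<Prod>i<k. (1 - B ^ (2 * i + 1) * A) * (1 - B ^ (2 * i + 1) / A))"
  using assms(3)
proof (induction k)
  case 0
  have "(\<Sum>j=-int N..int N. (-1) powi j * A powi j * B powi (j * j) * cgbin B 0 j)
      = (\<Sum>j\<in>{0}. (-1) powi j * A powi j * B powi (j * j) * cgbin B 0 j)"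
    by (rule sum.mono_neutral_right) (auto simp: cgbin_0)
  then show ?case by (simp add: cgbin_0)
next
  case (Suc k)
  define c where "c k j = (-1) powi j * A powi j * B powi (j * j) * cgbin B k j" for k j
  define b where "b = B ^ (2 * k + 1)"
  have bb: "B ^ (4 * k + 2) = b\<^sup>2"
    by (simp add: b_def power2_eq_square flip: power_add)
  have c_rec: "c (Suc k) j = (1 + b\<^sup>2) * c k j + (- (b * A)) * c k (j + -1) + (- (b / A)) * c k (j + 1)" for j
  proof -
    define Q where "Q = B powi (j * j)"
    define s where "s = (-1 :: 'a) powi j * A powi j"
    \<comment> \<open>Completing the square moves the quadratic exponent to the neighbouring
      index.\<close>
    have 1: "B powi (2 * (int k + 1 - j)) * Q = b * B powi ((j - 1) * (j - 1))"
    proof -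
      have "2 * (int k + 1 - j) + j * j = int (2 * k + 1) + (j - 1) * (j - 1)"
        by (simp add: algebra_simps)
      then show ?thesis
        unfolding Q_def b_def using assms(2) by (metis power_int_add power_int_of_nat)
    qed
    have 2: "B powi (2 * (int k + 1 + j)) * Q = b * B powi ((j + 1) * (j + 1))"
    proof -
      have "2 * (int k + 1 + j) + j * j = int (2 * k + 1) + (j + 1) * (j + 1)"
        by (simp add: algebra_simps)
      then show ?thesis
        unfolding Q_def b_def using assms(2) by (metis power_int_add power_int_of_nat)
    qed
    have s1: "(-1) powi (j + -1) * A powi (j + -1) = - s / A"
      and s2: "(-1) powi (j + 1) * A powi (j + 1) = - s * A"
      using assms(1) by (simp_all add: s_def power_int_add power_int_diff)
    have "c (Suc k) j = s * ((1 + b\<^sup>2) * Q * cgbin B k j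
        + (B powi (2 * (int k + 1 - j)) * Q) * cgbin B k (j - 1)
        + (B powi (2 * (int k + 1 + j)) * Q) * cgbin B k (j + 1))"
      unfolding c_def cgbin_Suc[OF assms(2)] bb s_def Q_def by (simp add: algebra_simps)
    also have "\<dots> = (1 + b\<^sup>2) * c k j + (- (b * A)) * c k (j + -1) + (- (b / A)) * c k (j + 1)"
      unfolding 1 2 c_def s1 s2 using assms(1) by (simp add: s_def Q_def algebra_simps)
    finally show ?thesis .
  qed
  have zero: "c k j = 0" if "int N \<le> \<bar>j\<bar>" for j
    using that Suc.prems by (simp add: c_def cgbin_eq_0)
  have "(\<Sum>j=-int N..int N. c (Suc k) j) = (1 + b\<^sup>2) * (\<Sum>j=-int N..int N. c k j)
      + (- (b * A)) * (\<Sum>j=-int N..int N. c k (j + -1)) + (- (b / A)) * (\<Sum>j=-int N..int N. c k (j + 1))"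
    by (simp only: c_rec sum.distrib sum_distrib_left)
  also have "(\<Sum>j=-int N..int N. c k (j + -1)) = (\<Sum>j=-int N..int N. c k j)"
    by (rule sum_int_shift) (simp_all add: zero)
  also have "(\<Sum>j=-int N..int N. c k (j + 1)) = (\<Sum>j=-int N..int N. c k j)"
    by (rule sum_int_shift) (simp_all add: zero)
  also have "(1 + b\<^sup>2) * (\<Sum>j=-int N..int N. c k j) + (- (b * A)) * (\<Sum>j=-int N..int N. c k j)
      + (- (b / A)) * (\<Sum>j=-int N..int N. c k j)
      = (\<Sum>j=-int N..int N. c k j) * ((1 - b * A) * (1 - b / A))"
    using assms(1) by (simp add: field_simps power2_eq_square)
  finally show ?case
    using Suc unfolding c_def b_def by simp
qed

text \<open>Abel summation: raising \<open>N\<close> adds the terms at N + 1 and -(N + 1) to the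
  inner sum, and evenness of \<open>G\<close> gives both the same factor.\<close>

lemma sum_by_parts_symmetric:
  fixes G s :: "int \<Rightarrow> 'a::comm_ring_1"
  assumes "\<And>j. G (- j) = G j"
  shows "(\<Sum>r\<le>N. (G (int r) - G (int r + 1)) * (\<Sum>j=-int r..int r. s j))
      = (\<Sum>j=-int N..int N. s j * G j) - G (int N + 1) * (\<Sum>j=-int N..int N. s j)"
proof (induction N)
  case 0
  show ?case by (simp add: algebra_simps)
next
  case (Suc N)
  have split: "(\<Sum>j=-int (Suc N)..int (Suc N). f j)
      = (\<Sum>j=-int N..int N. f j) + f (int N + 1) + f (- (int N + 1))" for f :: "int \<Rightarrow> 'a"
  proof -
    have "{-int (Suc N)..int (Suc N)} = insert (int N + 1) (insert (- (int N + 1)) {-int N..int N})"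
      by auto
    then show ?thesis by (simp add: algebra_simps)
  qed
  show ?case
    unfolding sum.atMost_Suc Suc.IH split assms by (simp add: algebra_simps)
qed

text \<open>
  The coefficient of the Chebyshev polynomial \<open>U\<^bsub>2r\<^esub>(x)\<close>, \<open>y = x\<^sup>2\<close>, in \<open>\<phi> k\<close>, read off from the finite
  Jacobi triple product and continued to all integers \<open>r\<close>.
\<close>
definition cheb_coeff :: "'a::field \<Rightarrow> nat \<Rightarrow> int \<Rightarrow> 'a" where
  "cheb_coeff B k r = B powi (r * (r - 1)) * cgbin B k r
     - B powi ((r + 1) * (r + 2)) * cgbin B k (r + 1)"

text \<open>The factor B^(r(r+1)) is the one that can be pulled out of the inner theta sum; with it
  the coefficient becomes a difference G r - G (r + 1), ready for summation by parts.\<close>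

lemma cheb_coeff_eq:
  assumes "B \<noteq> 0"
  shows "cheb_coeff B k r * B powi (r * (r + 1))
      = B powi (2 * (r * r)) * cgbin B k r - B powi (2 * ((r + 1) * (r + 1))) * cgbin B k (r + 1)"
proof -
  have "B powi (r * (r - 1)) * B powi (r * (r + 1)) = B powi (2 * (r * r))"
    using assms by (simp add: algebra_simps flip: power_int_add)
  moreover have "B powi ((r + 1) * (r + 2)) * B powi (r * (r + 1)) = B powi (2 * ((r + 1) * (r + 1)))"
    using assms by (simp add: algebra_simps flip: power_int_add)
  ultimately show ?thesis
    unfolding cheb_coeff_def by (simp add: algebra_simps flip: mult.assoc)
qed

text \<open>Mirrors U_(-2) = - U_0 and supplies the missing neighbour below height 0: c(-1) + 2 c(0)
  = c(0).\<close>

lemma cheb_coeff_minus_1: "B \<noteq> 0 \<Longrightarrow> cheb_coeff B k (- 1) = - cheb_coeff B k 0"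
  using cgbin_uminus[of B k 1] by (simp add: cheb_coeff_def)

text \<open>Since y U_(2r) = U_(2r-2) + 2 U_(2r) + U_(2r+2), this reads \<phi> (k + 1) = ((1 -
  B^(2k))^2 + B^(2k) y) \<phi> k coefficientwise.\<close>

lemma cheb_coeff_Suc:
  assumes "B \<noteq> 0"
  shows "cheb_coeff B (Suc k) r = (1 - B ^ (2 * k))\<^sup>2 * cheb_coeff B k r
      + B ^ (2 * k) * (cheb_coeff B k (r - 1) + 2 * cheb_coeff B k r + cheb_coeff B k (r + 1))"
proof -
  define X W Q Z where "X = B powi r" and "W = B powi (- r)" and "Q = B powi (r * r)" and "Z = B ^ k"
  have XW: "X * W = 1"
    using assms by (simp add: X_def W_def flip: power_int_add)
  have pw: "B powi m = Q * X ^ i * W ^ j * B ^ n" if "m = r * r + int i * r - int j * r + int n" for m i j n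
  proof -
    have m: "m = r * r + r * int i + - r * int j + int n" using that by (simp add: algebra_simps)
    show ?thesis
      unfolding m X_def W_def Q_def power_int_power' using assms by (simp only: power_int_add simp_thms power_int_of_nat)
  qed
  have pw2: "B powi m = Z\<^sup>2 * X ^ i * W ^ j * B ^ n" if "m = 2 * int k + int i * r - int j * r + int n" for m i j n
  proof -
    have m: "m = int (k * 2) + r * int i + - r * int j + int n" using that by (simp add: algebra_simps)
    show ?thesis
      unfolding m X_def W_def Z_def power_int_power' power_mult[symmetric]
      using assms by (simp only: power_int_add simp_thms power_int_of_nat)
  qed
  have e: "B powi (r * (r - 1)) = Q * W"
    "B powi ((r + 1) * (r + 2)) = Q * X ^ 3 * B\<^sup>2"
    "B powi ((r - 1) * (r - 1 - 1)) = Q * W ^ 3 * B\<^sup>2"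
    "B powi ((r - 1 + 1) * (r - 1 + 2)) = Q * X"
    "B powi ((r + 1) * (r + 1 - 1)) = Q * X"
    "B powi ((r + 1 + 1) * (r + 1 + 2)) = Q * X ^ 5 * B ^ 6"
  proof -
    show "B powi (r * (r - 1)) = Q * W"
      using pw[of "r * (r - 1)" 0 1 0] by (simp add: algebra_simps)
    show "B powi ((r + 1) * (r + 2)) = Q * X ^ 3 * B\<^sup>2"
      using pw[of "(r + 1) * (r + 2)" 3 0 2] by (simp add: algebra_simps)
    show "B powi ((r - 1) * (r - 1 - 1)) = Q * W ^ 3 * B\<^sup>2"
      using pw[of "(r - 1) * (r - 1 - 1)" 0 3 2] by (simp add: algebra_simps)
    show "B powi ((r - 1 + 1) * (r - 1 + 2)) = Q * X"
      using pw[of "(r - 1 + 1) * (r - 1 + 2)" 1 0 0] by (simp add: algebra_simps)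
    show "B powi ((r + 1) * (r + 1 - 1)) = Q * X"
      using pw[of "(r + 1) * (r + 1 - 1)" 1 0 0] by (simp add: algebra_simps)
    show "B powi ((r + 1 + 1) * (r + 1 + 2)) = Q * X ^ 5 * B ^ 6"
      using pw[of "(r + 1 + 1) * (r + 1 + 2)" 5 0 6] by (simp add: algebra_simps)
  qed
  have f: "B powi (2 * (int k + 1 - r)) = Z\<^sup>2 * W\<^sup>2 * B\<^sup>2"
    "B powi (2 * (int k + 1 + r)) = Z\<^sup>2 * X\<^sup>2 * B\<^sup>2"
    "B powi (2 * (int k + 1 - (r + 1))) = Z\<^sup>2 * W\<^sup>2"
    "B powi (2 * (int k + 1 + (r + 1))) = Z\<^sup>2 * X\<^sup>2 * B ^ 4"
    "B powi (2 * (int k + r + 1)) = Z\<^sup>2 * X\<^sup>2 * B\<^sup>2"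
    "B powi (2 * (int k - r)) = Z\<^sup>2 * W\<^sup>2"
  proof -
    show "B powi (2 * (int k + 1 - r)) = Z\<^sup>2 * W\<^sup>2 * B\<^sup>2"
      using pw2[of "2 * (int k + 1 - r)" 0 2 2] by (simp add: algebra_simps)
    show "B powi (2 * (int k + 1 + r)) = Z\<^sup>2 * X\<^sup>2 * B\<^sup>2"
      using pw2[of "2 * (int k + 1 + r)" 2 0 2] by (simp add: algebra_simps)
    show "B powi (2 * (int k + 1 - (r + 1))) = Z\<^sup>2 * W\<^sup>2"
      using pw2[of "2 * (int k + 1 - (r + 1))" 0 2 0] by (simp add: algebra_simps)
    show "B powi (2 * (int k + 1 + (r + 1))) = Z\<^sup>2 * X\<^sup>2 * B ^ 4"
      using pw2[of "2 * (int k + 1 + (r + 1))" 2 0 4] by (simp add: algebra_simps)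
    show "B powi (2 * (int k + r + 1)) = Z\<^sup>2 * X\<^sup>2 * B\<^sup>2"
      using pw2[of "2 * (int k + r + 1)" 2 0 2] by (simp add: algebra_simps)
    show "B powi (2 * (int k - r)) = Z\<^sup>2 * W\<^sup>2"
      using pw2[of "2 * (int k - r)" 0 2 0] by (simp add: algebra_simps)
  qed
  have z: "B ^ (4 * k + 2) = Z ^ 4 * B\<^sup>2" "B ^ (2 * k) = Z\<^sup>2"
    unfolding Z_def power_mult[symmetric] mult.commute[of k] by (simp_all only: power_add)
  have i: "r + 1 - 1 = r" "r - 1 + 1 = r" by simp_all
  define g0 g1 g2 gm where "g0 = cgbin B k r" and "g1 = cgbin B k (r + 1)"
    and "g2 = cgbin B k (r + 1 + 1)" and "gm = cgbin B k (r - 1)"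
  have ratio: "(1 - Z\<^sup>2 * X\<^sup>2 * B\<^sup>2) * g1 = (1 - Z\<^sup>2 * W\<^sup>2) * g0"
    using cgbin_ratio[OF assms, of k r] unfolding f g0_def g1_def .
  have W: "W = 1 / X" "X \<noteq> 0"
    using assms by (simp_all add: X_def W_def power_int_minus_divide)
  \<comment> \<open>After \<open>cgbin_Suc\<close> the two sides differ by a multiple of
    \<open>ratio\<close> alone.\<close>
  have "Q * W * ((1 + Z ^ 4 * B\<^sup>2) * g0 + Z\<^sup>2 * W\<^sup>2 * B\<^sup>2 * gm + Z\<^sup>2 * X\<^sup>2 * B\<^sup>2 * g1)
      - Q * X ^ 3 * B\<^sup>2 * ((1 + Z ^ 4 * B\<^sup>2) * g1 + Z\<^sup>2 * W\<^sup>2 * g0 + Z\<^sup>2 * X\<^sup>2 * B ^ 4 * g2)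
    - ((1 - Z\<^sup>2)\<^sup>2 * (Q * W * g0 - Q * X ^ 3 * B\<^sup>2 * g1)
      + Z\<^sup>2 * ((Q * W ^ 3 * B\<^sup>2 * gm - Q * X * g0) + 2 * (Q * W * g0 - Q * X ^ 3 * B\<^sup>2 * g1)
         + (Q * X * g1 - Q * X ^ 5 * B ^ 6 * g2)))
    = Q * Z\<^sup>2 * (B\<^sup>2 - 1) * X * ((1 - Z\<^sup>2 * X\<^sup>2 * B\<^sup>2) * g1 - (1 - Z\<^sup>2 * W\<^sup>2) * g0)"
    using W(2) unfolding W(1) by (simp add: field_simps eval_nat_numeral)
  also have "\<dots> = 0" unfolding ratio by simp
  finally have "Q * W * ((1 + Z ^ 4 * B\<^sup>2) * g0 + Z\<^sup>2 * W\<^sup>2 * B\<^sup>2 * gm + Z\<^sup>2 * X\<^sup>2 * B\<^sup>2 * g1)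
      - Q * X ^ 3 * B\<^sup>2 * ((1 + Z ^ 4 * B\<^sup>2) * g1 + Z\<^sup>2 * W\<^sup>2 * g0 + Z\<^sup>2 * X\<^sup>2 * B ^ 4 * g2)
    = (1 - Z\<^sup>2)\<^sup>2 * (Q * W * g0 - Q * X ^ 3 * B\<^sup>2 * g1)
      + Z\<^sup>2 * ((Q * W ^ 3 * B\<^sup>2 * gm - Q * X * g0) + 2 * (Q * W * g0 - Q * X ^ 3 * B\<^sup>2 * g1)
         + (Q * X * g1 - Q * X ^ 5 * B ^ 6 * g2))"
    by (simp only: right_minus_eq)
  then show ?thesis
    unfolding cheb_coeff_def e cgbin_Suc[OF assms] f z unfolding i g0_def g1_def g2_def gm_def .
qed

section \<open>The moment formula\<close>

text \<open>For q other than 0 and 1 this is (1 - q)^2 times \<open>lam a b q n\<close>, with A =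
  q^a and B = q^b as independent parameters.\<close>

definition qweight :: "'a::field \<Rightarrow> 'a \<Rightarrow> nat \<Rightarrow> 'a" where
  "qweight A B n = (if odd n then (1 - B ^ n * A) * (1 - B ^ n / A) else (1 - B ^ n)\<^sup>2)"

text \<open>By \<open>jac_step_product_form\<close> it suffices to treat B^(h(h-1)) times the
  Gaussian binomial; its recurrences follow from the ratio of neighbouring binomials.\<close>

lemma jac_step_qweight_product:
  fixes A B :: "'a::field"
  assumes "A \<noteq> 0" "B \<noteq> 0"
  defines "D \<equiv> \<lambda>k h. (\<Prod>i<h. B ^ (2 * i)) * gbin (B\<^sup>2) k (int h) * (\<Prod>i=h..<k. qweight A B (2 * i + 1))"
  shows "D (Suc k) h = (1 - B ^ (2 * k))\<^sup>2 * D k h + B ^ (2 * k) * jac_step (qweight A B) (D k) h"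
  unfolding D_def
proof (rule jac_step_product_form)
  \<comment> \<open>An odd weight depends on \<open>A\<close> only through this sum, and linearly,
    so the identities to check become polynomial.\<close>
  define C where "C = A + 1 / A"
  have odd: "qweight A B (2 * k + 1) = 1 + B ^ (4 * k) * B\<^sup>2 - B ^ (2 * k) * B * C" for k
  proof -
    have "B ^ (4 * k) = B ^ (2 * k) * B ^ (2 * k)"
      by (simp flip: power_add)
    then show ?thesis
      using assms(1) by (simp add: qweight_def C_def field_simps power2_eq_square)
  qed
  have even: "qweight A B (2 * k) = (1 - B ^ (2 * k))\<^sup>2" for k
    by (simp add: qweight_def)
  have p: "B\<^sup>2 \<noteq> 0" using assms by simp
  fix k :: nat
  define Z where "Z = B ^ (2 * k)"
  have Z4: "B ^ (4 * k) = Z\<^sup>2"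
    by (simp add: Z_def flip: power_mult)
  {
    define g0 g1 where "g0 = gbin (B\<^sup>2) k 0" and "g1 = gbin (B\<^sup>2) k 1"
    have w: "qweight A B 0 = 0" "qweight A B 1 = 1 + B\<^sup>2 - B * C" "qweight A B 2 = (1 - B\<^sup>2)\<^sup>2"
      "gbin (B\<^sup>2) (Suc k) 0 = g0"
      using even[of 0] odd[of 0] even[of 1] by (simp_all add: gbin_eq_0 g0_def)
    have "(1 - B\<^sup>2) * g1 = (1 - Z) * g0"
      using gbin_ratio[OF p, of 0 k] by (simp add: g0_def g1_def Z_def power_mult)
    then have "g0 * (1 + Z\<^sup>2 * B\<^sup>2 - Z * B * C)
        = g0 * ((1 - Z)\<^sup>2 + Z * (0 + (1 + B\<^sup>2 - B * C))) + Z * ((1 - B\<^sup>2)\<^sup>2 * g1)"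
      by algebra
    then show "(\<Prod>i<0. B ^ (2 * i)) * gbin (B\<^sup>2) (Suc k) (int 0) * qweight A B (2 * k + 1)
        = (\<Prod>i<0. B ^ (2 * i)) * gbin (B\<^sup>2) k (int 0)
            * ((1 - B ^ (2 * k))\<^sup>2 + B ^ (2 * k) * (qweight A B 0 + qweight A B 1))
          + B ^ (2 * k) * (qweight A B 2 * ((\<Prod>i<1. B ^ (2 * i)) * gbin (B\<^sup>2) k (int 1)))"
      unfolding odd[of k] Z4 of_nat_0 w Z_def[symmetric] by (simp add: g0_def g1_def)
  next
    fix h :: nat
    assume "h < k"
    define X Y where "X = B ^ (2 * h)" and "Y = (B\<^sup>2) powi (int k - int h)"
    have XY: "X * Y = Z"
      using assms(2) by (simp add: X_def Y_def Z_def power_int_diff power_mult)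
    define g0 g1 g2 where "g0 = gbin (B\<^sup>2) k (int h)" and "g1 = gbin (B\<^sup>2) k (int h + 1)"
      and "g2 = gbin (B\<^sup>2) k (int h + 1 + 1)"
    define P where "P = (\<Prod>i<h. B ^ (2 * i))"
    have B4: "B ^ 4 = B\<^sup>2 * B\<^sup>2" by (simp flip: power_add)
    have pw: "(B\<^sup>2) powi (int h + 1) = X * B\<^sup>2" "(B\<^sup>2) powi (int h + 1 + 1) = X * B ^ 4"
      "(B\<^sup>2) powi (int k - int h) = Y" "(B\<^sup>2) powi (int k - (int h + 1)) * B\<^sup>2 = Y"
      using assms(2) B4 by (simp_all add: X_def Y_def power_int_add power_int_diff power_mult)
    \<comment> \<open>\<open>r1\<close> and \<open>r2\<close> are the ratio relations multiplied so
      that only \<open>Z\<close>, not \<open>Y\<close>, occurs.\<close>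
    have r1: "X * (1 - X * B\<^sup>2) * g1 = (X - Z) * g0"
    proof -
      have "(1 - X * B\<^sup>2) * g1 = (1 - Y) * g0"
        using gbin_ratio[OF p, of "int h" k] unfolding pw g0_def g1_def .
      then show ?thesis using XY by algebra
    qed
    have r2: "X * B\<^sup>2 * (1 - X * B ^ 4) * g2 = (X * B\<^sup>2 - Z) * g1"
    proof -
      have "(1 - X * B ^ 4) * g2 = (1 - (B\<^sup>2) powi (int k - (int h + 1))) * g1"
        using gbin_ratio[OF p, of "int h + 1" k] unfolding pw g2_def g1_def .
      then show ?thesis using XY pw(4) by algebra
    qed
    have w: "qweight A B (2 * h + 2) = (1 - X * B\<^sup>2)\<^sup>2" "qweight A B (2 * h + 4) = (1 - X * B ^ 4)\<^sup>2"
      "qweight A B (2 * h + 1) = 1 + X\<^sup>2 * B\<^sup>2 - X * B * C"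
      "qweight A B (2 * h + 3) = 1 + X\<^sup>2 * B ^ 6 - X * B ^ 3 * C"
      using even[of "h + 1"] even[of "h + 2"] odd[of h] odd[of "h + 1"]
      by (simp_all add: X_def power_add eval_nat_numeral algebra_simps flip: power_mult)
    have g: "gbin (B\<^sup>2) (Suc k) (int (Suc h)) = g0 + X * B\<^sup>2 * g1" "gbin (B\<^sup>2) k (int (Suc h)) = g1"
      "gbin (B\<^sup>2) k (int (h + 2)) = g2"
      using pw(1) by (simp_all add: g0_def g1_def g2_def add.commute)
    have P: "(\<Prod>i<Suc h. B ^ (2 * i)) = P * X" "(\<Prod>i<h + 2. B ^ (2 * i)) = P * X * (X * B\<^sup>2)"
      by (simp_all add: P_def X_def power2_eq_square)
    have "P * X * (g0 + X * B\<^sup>2 * g1) * (1 + Z\<^sup>2 * B\<^sup>2 - Z * B * C)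
        = P * X * g1 * ((1 - Z)\<^sup>2 + Z * ((1 - X * B\<^sup>2)\<^sup>2 + (1 + X\<^sup>2 * B ^ 6 - X * B ^ 3 * C)))
          + Z * (P * g0 * (1 + X\<^sup>2 * B\<^sup>2 - X * B * C) + (1 - X * B ^ 4)\<^sup>2 * (P * X * (X * B\<^sup>2) * g2))"
      using r1 r2 by algebra
    then show "(\<Prod>i<Suc h. B ^ (2 * i)) * gbin (B\<^sup>2) (Suc k) (int (Suc h)) * qweight A B (2 * k + 1)
        = (\<Prod>i<Suc h. B ^ (2 * i)) * gbin (B\<^sup>2) k (int (Suc h))
            * ((1 - B ^ (2 * k))\<^sup>2 + B ^ (2 * k) * (qweight A B (2 * h + 2) + qweight A B (2 * h + 3)))
          + B ^ (2 * k) * ((\<Prod>i<h. B ^ (2 * i)) * gbin (B\<^sup>2) k (int h) * qweight A B (2 * h + 1)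
            + qweight A B (2 * h + 4) * ((\<Prod>i<h + 2. B ^ (2 * i)) * gbin (B\<^sup>2) k (int (h + 2))))"
      unfolding odd[of k] Z4 w g P Z_def[symmetric] P_def[symmetric] g0_def[symmetric] .
  next
    show "(\<Prod>i<Suc k. B ^ (2 * i)) * gbin (B\<^sup>2) (Suc k) (int (Suc k))
        = B ^ (2 * k) * ((\<Prod>i<k. B ^ (2 * i)) * gbin (B\<^sup>2) k (int k))"
      by (simp add: gbin_self del: gbin.simps of_nat_Suc)
  next
    fix h :: nat
    assume "k < h"
    then show "(\<Prod>i<h. B ^ (2 * i)) * gbin (B\<^sup>2) k (int h) = 0"
      by (simp add: gbin_eq_0)
  }
qed

section \<open>Comparison of the two functionals\<close>

definition theta_sum :: "'a::field \<Rightarrow> 'a \<Rightarrow> nat \<Rightarrow> 'a" where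
  "theta_sum A B k = (\<Sum>j=-int k..int k. (-1) powi j * A powi j * B powi (int k * (int k + 1) - j * j))"

text \<open>The value at \<phi> k of the functional sending U_(2r) to the theta sum. The boundary
  term of the summation by parts vanishes because N + 1 > k, and B^(-j^2) B^(2j^2) = B^(j^2) leaves
  the finite triple product.\<close>

lemma sum_cheb_coeff_theta_sum:
  fixes A B :: "'a::field"
  assumes "A \<noteq> 0" "B \<noteq> 0" "k \<le> N"
  shows "(\<Sum>r\<le>N. cheb_coeff B k (int r) * theta_sum A B r)
      = (\<Prod>i<k. (1 - B ^ (2 * i + 1) * A) * (1 - B ^ (2 * i + 1) / A))"
proof -
  define s where "s j = (-1) powi j * A powi j * B powi (- (j * j))" for j
  define G where "G j = B powi (2 * (j * j)) * cgbin B k j" for j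
  have th: "theta_sum A B r = B powi (int r * (int r + 1)) * (\<Sum>j=-int r..int r. s j)" for r
    unfolding theta_sum_def s_def sum_distrib_left
    using assms(2) by (intro sum.cong refl) (simp add: power_int_diff power_int_minus field_simps)
  have "(\<Sum>r\<le>N. cheb_coeff B k (int r) * theta_sum A B r)
      = (\<Sum>r\<le>N. (G (int r) - G (int r + 1)) * (\<Sum>j=-int r..int r. s j))"
    unfolding th G_def cheb_coeff_eq[OF assms(2), symmetric] by (simp only: mult.assoc)
  also have "\<dots> = (\<Sum>j=-int N..int N. s j * G j) - G (int N + 1) * (\<Sum>j=-int N..int N. s j)"
    using assms(2) by (intro sum_by_parts_symmetric) (simp add: G_def cgbin_uminus)
  also have "G (int N + 1) = 0"
    using assms(3) by (simp add: G_def cgbin_eq_0)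
  also have "(\<Sum>j=-int N..int N. s j * G j)
      = (\<Sum>j=-int N..int N. (-1) powi j * A powi j * B powi (j * j) * cgbin B k j)"
  proof (intro sum.cong refl)
    fix j
    have "B powi (- (j * j)) * B powi (2 * (j * j)) = B powi (j * j)"
      using assms(2) by (simp flip: power_int_add)
    then show "s j * G j = (-1) powi j * A powi j * B powi (j * j) * cgbin B k j"
      by (simp add: s_def G_def mult.assoc flip: mult.assoc[of "B powi (- (j * j))"])
  qed
  also note finite_jacobi_triple[OF assms]
  finally show ?thesis by simp
qed

text \<open>The weights of the Chebyshev polynomials of the second kind: every Dyck path counts
  1.\<close>

definition free_weight :: "nat \<Rightarrow> 'a::field" where
  "free_weight m = (if m = 0 then 0 else 1)"

lemma jac_step_cheb_coeff:
  assumes "B \<noteq> 0"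
  shows "cheb_coeff B (Suc k) (int h) = (1 - B ^ (2 * k))\<^sup>2 * cheb_coeff B k (int h)
      + B ^ (2 * k) * jac_step free_weight (\<lambda>h. cheb_coeff B k (int h)) h"
proof -
  have "jac_step free_weight (\<lambda>h. cheb_coeff B k (int h)) h
      = cheb_coeff B k (int h - 1) + 2 * cheb_coeff B k (int h) + cheb_coeff B k (int h + 1)"
    using cheb_coeff_minus_1[OF assms, of k]
    by (cases h) (simp_all add: jac_step_def free_weight_def algebra_simps)
  then show ?thesis using cheb_coeff_Suc[OF assms] by simp
qed

lemma moment_qweight:
  fixes A B :: "'a::field"
  assumes "A \<noteq> 0" "B \<noteq> 0"
  shows "(jac_step (qweight A B) ^^ n) unit0 0
      = (\<Sum>r\<le>n. (jac_step free_weight ^^ n) unit0 r * theta_sum A B r)"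
proof -
  define D where "D k h = (\<Prod>i<h. B ^ (2 * i)) * gbin (B\<^sup>2) k (int h) * (\<Prod>i=h..<k. qweight A B (2 * i + 1))" for k h
  define E where "E k h = cheb_coeff B k (int h)" for k h
  define M where "M i k = (jac_step (qweight A B) ^^ i) (D k) 0" for i k
  \<comment> \<open>The cut-off \<open>n\<close> stays fixed: the recurrence in \<open>k\<close>
    holds for each \<open>r\<close> separately, and completeness of the range matters only for
    \<open>i = 0\<close>, where \<open>k \<le> n\<close>.\<close>
  define M' where "M' i k = (\<Sum>r\<le>n. (jac_step free_weight ^^ i) (E k) r * theta_sum A B r)" for i k
  have D_rec: "D (Suc k) h = (1 - B ^ (2 * k))\<^sup>2 * D k h + B ^ (2 * k) * jac_step (qweight A B) (D k) h" for k h
    unfolding D_def by (rule jac_step_qweight_product[OF assms])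
  have E_rec: "E (Suc k) h = (1 - B ^ (2 * k))\<^sup>2 * E k h + B ^ (2 * k) * jac_step free_weight (E k) h" for k h
    unfolding E_def by (rule jac_step_cheb_coeff[OF assms(2)])
  have "M n 0 = M' n 0"
  proof (rule double_index_unique)
    show "M i (Suc k) = (1 - B ^ (2 * k))\<^sup>2 * M i k + B ^ (2 * k) * M (Suc i) k" for i k
      unfolding M_def by (rule jac_step_iter_comb) (rule D_rec)
    show "M' i (Suc k) = (1 - B ^ (2 * k))\<^sup>2 * M' i k + B ^ (2 * k) * M' (Suc i) k" for i k
    proof -
      have "(jac_step free_weight ^^ i) (E (Suc k)) h = (1 - B ^ (2 * k))\<^sup>2 * (jac_step free_weight ^^ i) (E k) h
          + B ^ (2 * k) * (jac_step free_weight ^^ Suc i) (E k) h" for h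
        by (rule jac_step_iter_comb) (rule E_rec)
      then show ?thesis
        unfolding M'_def by (simp only: sum_distrib_left sum.distrib distrib_right mult.assoc)
    qed
    show "B ^ (2 * k) \<noteq> 0" for k using assms by simp
    show "M 0 k = M' 0 k" if "k \<le> n" for k
    proof -
      have "gbin (B\<^sup>2) k 0 = 1"
        by (induction k) (simp_all add: gbin_eq_0)
      then have "M 0 k = (\<Prod>i<k. qweight A B (2 * i + 1))"
        by (simp add: M_def D_def atLeast0LessThan)
      moreover have "M' 0 k = (\<Prod>i<k. qweight A B (2 * i + 1))"
        using sum_cheb_coeff_theta_sum[OF assms that] by (simp add: M'_def E_def qweight_def)
      ultimately show ?thesis by simp
    qed
    show "n + 0 \<le> n" by simp
  qed
  moreover have "D 0 = unit0" "E 0 = unit0"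
    by (auto simp: D_def E_def unit0_def cheb_coeff_def cgbin_0)
  ultimately show ?thesis by (simp add: M_def M'_def)
qed

section \<open>Ballot numbers and the explicit formula\<close>

lemma binom_Suc: "binom (Suc n) k = binom n k + binom n (k - 1)"
proof (cases "k \<le> 0")
  case True
  then show ?thesis by (cases "k = 0") (simp_all add: binom_def)
next
  case False
  then have "nat k = Suc (nat (k - 1))" by simp
  then show ?thesis using False by (simp add: binom_def)
qed

lemma binom_sym: "binom n (int n - k) = binom n k"
proof (cases "0 \<le> k \<and> k \<le> int n")
  case True
  then have "nat (int n - k) = n - nat k" by (simp add: nat_diff_distrib)
  then show ?thesis using True binomial_symmetric[of "nat k" n] by (simp add: binom_def nat_le_iff)
next
  case False
  then show ?thesis by (auto simp: binom_def)
qed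

text \<open>The coefficient of U_(2r) in x^(2n). The binomial difference, continued to negative
  heights, obeys the free recurrence, and its antisymmetry \<open>b (- 1) = - b 0\<close>
  (reflection principle) gives the boundary rule at height 0.\<close>

lemma ballot_moment:
  "(jac_step free_weight ^^ n) unit0 r
     = of_int (binom (2 * n) (int n - int r) - binom (2 * n) (int n - int r - 1))"
proof (induction n arbitrary: r)
  case 0
  show ?case by (simp add: unit0_def binom_def)
next
  case (Suc n)
  define b where "b j = binom (2 * n) (int n - j) - binom (2 * n) (int n - j - 1)" for j
  have IH: "(jac_step free_weight ^^ n) unit0 = (\<lambda>r. of_int (b (int r)) :: 'a)"
    using Suc.IH by (auto simp: b_def)
  have b_neg: "b (- 1) = - b 0"
    using binom_sym[of "2 * n" "int n - 1"] by (simp add: b_def algebra_simps)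
  have rec: "binom (2 * Suc n) (int (Suc n) - j) - binom (2 * Suc n) (int (Suc n) - j - 1)
      = b (j - 1) + 2 * b j + b (j + 1)" for j
    by (simp add: binom_Suc b_def algebra_simps)
  have "jac_step free_weight (\<lambda>r. of_int (b (int r)) :: 'a) r
      = of_int (b (int r - 1) + 2 * b (int r) + b (int r + 1))"
    using b_neg by (cases r) (simp_all add: jac_step_def free_weight_def algebra_simps)
  then show ?case
    unfolding rec funpow.simps o_apply IH .
qed

text \<open>The weight at index 0 vanishes because \<open>q powr 0 = 1\<close>, which fails at
  \<open>q = 0\<close>.\<close>

lemma mu_eq_moment:
  assumes "q \<noteq> 0"
  shows "mu n a b q = (jac_step (lam a b q) ^^ n) unit0 0"
  unfolding mu_def using assms by (intro sfrac_nth_eq_jac_step) (simp add: lam_def qnum_def)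

lemma powr_of_int_mult:
  fixes q :: complex
  assumes "q \<noteq> 0"
  shows "q powr (a * of_int j) = (q powr a) powi j"
  using assms by (simp add: powr_def exp_power_int mult_ac)

lemma mu_formula:
  assumes "q \<noteq> 0" "q \<noteq> 1"
  shows "mu n a b q =
    1 / (1 - q) ^ (2 * n) *
    (\<Sum>k=0..n. of_int (binom (2 * n) (int n - int k) - binom (2 * n) (int n - int k - 1)) *
      (\<Sum>j=- int k..int k.
        (-1) powi j * q powr (a * of_int j + b * of_int (int k * (int k + 1) - j\<^sup>2))))"
proof -
  define A B where "A = q powr a" and "B = q powr b"
  have nz: "A \<noteq> 0" "B \<noteq> 0" using assms by (simp_all add: A_def B_def)
  have pw: "q powr (of_nat m * b) = B ^ m" for m
    using powr_of_int_mult[OF assms(1), of b "int m"] by (simp add: B_def mult.commute)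
  \<comment> \<open>Rescaling all weights by (1 - q)^(-2) multiplies the n-th moment by (1 -
    q)^(-2n).\<close>
  have "lam a b q = (\<lambda>m. 1 / (1 - q)\<^sup>2 * qweight A B m)"
    using assms by (intro ext)
      (simp add: lam_def qnum_def qweight_def powr_add powr_diff pw A_def power_divide power2_eq_square)
  then have "mu n a b q = (1 / (1 - q)\<^sup>2) ^ n * (jac_step (qweight A B) ^^ n) unit0 0"
    using jac_step_iter_scale[where c = "1 / (1 - q)\<^sup>2" and l = "qweight A B" and h = 0]
    by (simp add: mu_eq_moment[OF assms(1)])
  also have "(1 / (1 - q)\<^sup>2) ^ n = 1 / (1 - q) ^ (2 * n)"
    by (simp add: power_divide power_mult)
  also have "(jac_step (qweight A B) ^^ n) unit0 0
      = (\<Sum>k=0..n. of_int (binom (2 * n) (int n - int k) - binom (2 * n) (int n - int k - 1)) * theta_sum A B k)"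
    unfolding moment_qweight[OF nz] ballot_moment atMost_atLeast0 ..
  also have "theta_sum A B = (\<lambda>k. \<Sum>j=- int k..int k.
        (-1) powi j * q powr (a * of_int j + b * of_int (int k * (int k + 1) - j\<^sup>2)))"
    unfolding theta_sum_def powr_add powr_of_int_mult[OF assms(1)] A_def B_def
    by (intro ext) (simp only: mult.assoc power2_eq_square)
  finally show ?thesis .
qed

section \<open>The exponential generating function\<close>

lemma lam_1: "lam a b 1 (2 * k + 1) = b\<^sup>2 * (2 * of_nat k + 1)\<^sup>2 - a\<^sup>2" "lam a b 1 (2 * k) = 4 * b\<^sup>2 * (of_nat k)\<^sup>2"
  by (simp_all add: lam_def qnum_def algebra_simps power2_eq_square)

text \<open>The counterpart of \<open>jac_step_qweight_product\<close> at q = 1, with ordinary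
  binomials and \<phi> (k + 1) = (y + 4 b^2 k^2) \<phi> k.\<close>

lemma jac_step_lam_1_product:
  fixes a b :: complex
  defines "D \<equiv> \<lambda>k h. of_nat (k choose h) * (\<Prod>i=h..<k. lam a b 1 (2 * i + 1))"
  shows "D (Suc k) h = 4 * b\<^sup>2 * (of_nat k)\<^sup>2 * D k h + 1 * jac_step (lam a b 1) (D k) h"
  unfolding D_def
proof (rule jac_step_product_form)
  fix k :: nat
  have w: "lam a b 1 0 = 0" "lam a b 1 1 = b\<^sup>2 - a\<^sup>2" "lam a b 1 2 = 4 * b\<^sup>2"
    using lam_1[of a b 0] lam_1[of a b 1] by simp_all
  show "of_nat (Suc k choose 0) * lam a b 1 (2 * k + 1)
      = of_nat (k choose 0) * (4 * b\<^sup>2 * (of_nat k)\<^sup>2 + 1 * (lam a b 1 0 + lam a b 1 1))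
        + 1 * (lam a b 1 2 * of_nat (k choose 1))"
    unfolding w lam_1(1) by (simp add: algebra_simps power2_eq_square)
  show "of_nat (Suc k choose Suc k) = (1::complex) * of_nat (k choose k)" by simp
  show "of_nat (k choose h) = (0::complex)" if "k < h" for h using that by simp
  fix h :: nat
  assume "h < k"
  define x y where "x = (of_nat h :: complex)" and "y = (of_nat k :: complex)"
  define c0 c1 c2 where "c0 = (of_nat (k choose h) :: complex)" and "c1 = (of_nat (k choose Suc h) :: complex)"
    and "c2 = (of_nat (k choose (h + 2)) :: complex)"
  have ratio: "of_nat (Suc i) * of_nat (k choose Suc i) = (of_nat k - of_nat i) * (of_nat (k choose i) :: complex)"
    if "i \<le> k" for i
  proof -
    have "Suc i * (k choose Suc i) = (k - i) * (k choose i)"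
      using binomial_absorb_comp[of k i] binomial_absorption[of i k] by simp
    then have "of_nat (Suc i * (k choose Suc i)) = (of_nat ((k - i) * (k choose i)) :: complex)"
      by (rule arg_cong)
    then show ?thesis using that by (simp only: of_nat_mult of_nat_diff)
  qed
  have r: "(x + 1) * c1 = (y - x) * c0" "(x + 2) * c2 = (y - x - 1) * c1"
    using ratio[of h] ratio[of "Suc h"] \<open>h < k\<close> by (simp_all add: x_def y_def c0_def c1_def c2_def algebra_simps)
  have w: "lam a b 1 (2 * h + 2) = 4 * b\<^sup>2 * (x + 1)\<^sup>2" "lam a b 1 (2 * h + 4) = 4 * b\<^sup>2 * (x + 2)\<^sup>2"
    "lam a b 1 (2 * h + 3) = b\<^sup>2 * (2 * x + 3)\<^sup>2 - a\<^sup>2"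
    using lam_1(2)[of a b "h + 1"] lam_1(2)[of a b "h + 2"] lam_1(1)[of a b "h + 1"]
    by (simp_all add: x_def eval_nat_numeral algebra_simps)
  have "(c0 + c1) * (b\<^sup>2 * (2 * y + 1)\<^sup>2 - a\<^sup>2)
      = c1 * (4 * b\<^sup>2 * y\<^sup>2 + 1 * (4 * b\<^sup>2 * (x + 1)\<^sup>2 + (b\<^sup>2 * (2 * x + 3)\<^sup>2 - a\<^sup>2)))
        + 1 * (c0 * (b\<^sup>2 * (2 * x + 1)\<^sup>2 - a\<^sup>2) + 4 * b\<^sup>2 * (x + 2)\<^sup>2 * c2)"
    using r by algebra
  then show "of_nat (Suc k choose Suc h) * lam a b 1 (2 * k + 1)
      = of_nat (k choose Suc h) * (4 * b\<^sup>2 * (of_nat k)\<^sup>2 + 1 * (lam a b 1 (2 * h + 2) + lam a b 1 (2 * h + 3)))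
        + 1 * (of_nat (k choose h) * lam a b 1 (2 * h + 1) + lam a b 1 (2 * h + 4) * of_nat (k choose (h + 2)))"
    unfolding w lam_1(1) by (simp add: x_def y_def c0_def c1_def c2_def)
qed

text \<open>Covers both operators that arise from differentiating G(sin(b z) / b) twice: c = d = b^2
  for the plain composite, d = 3 b^2 after multiplication by cos(b z).\<close>

lemma fps_nth_second_order:
  fixes G :: "'a::{idom,ring_char_0} fps"
  shows "fps_nth ((1 - fps_const c * fps_X * fps_X) * fps_deriv (fps_deriv G) - fps_const d * fps_X * fps_deriv G) m
    = of_nat (m + 1) * of_nat (m + 2) * fps_nth G (m + 2) - (c * of_nat m * (of_nat m - 1) + d * of_nat m) * fps_nth G m"
proof -
  have t1: "fps_nth (fps_X * fps_deriv G) m = of_nat m * fps_nth G m"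
    by (cases m) simp_all
  have t2: "fps_nth (fps_X * (fps_X * fps_deriv (fps_deriv G))) m = of_nat m * (of_nat m - 1) * fps_nth G m"
    by (cases m rule: nat.exhaust; cases "m - 1") (auto simp: algebra_simps)
  have t3: "(1 - fps_const c * fps_X * fps_X) * fps_deriv (fps_deriv G) - fps_const d * fps_X * fps_deriv G
     = fps_deriv (fps_deriv G) - fps_const c * (fps_X * (fps_X * fps_deriv (fps_deriv G))) - fps_const d * (fps_X * fps_deriv G)"
    by (simp add: algebra_simps)
  show ?thesis
    unfolding t3 fps_sub_nth fps_mult_left_const_nth t1 t2 by (simp add: algebra_simps)
qed

text \<open>The series \<open>s\<close> is \<open>sin (b z) / b\<close>, written as an integral so that \<open>b = 0\<close> is allowed.\<close>
lemma fps_deriv_compose_sin: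
  fixes b :: "'a::field_char_0"
  defines "s \<equiv> fps_integral0 (fps_cos b)"
  defines "B \<equiv> fps_const (b\<^sup>2)"
  shows "fps_deriv (G oo s) = (fps_deriv G oo s) * fps_cos b"
    and "fps_deriv (fps_deriv (G oo s)) = ((1 - B * fps_X * fps_X) * fps_deriv (fps_deriv G) - B * fps_X * fps_deriv G) oo s"
    and "fps_deriv (fps_deriv (fps_cos b * (G oo s)))
      = fps_cos b * (((1 - B * fps_X * fps_X) * fps_deriv (fps_deriv G) - fps_const (3 * b\<^sup>2) * fps_X * fps_deriv G - B * G) oo s)"
proof -
  have s0: "fps_nth s 0 = 0" by (simp add: s_def)
  have s': "fps_deriv s = fps_cos b" by (simp add: s_def fps_deriv_fps_integral)
  have sin: "fps_sin b = fps_const b * s"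
    using fps_integral0_deriv[of "fps_sin b"]
    by (simp add: fps_sin_deriv fps_integral0_fps_const_mult_left s_def)
  have "fps_cos b * fps_cos b + fps_sin b * fps_sin b = 1"
    using fps_sin_cos_sum_of_squares[of b] by (simp add: power2_eq_square)
  moreover have "fps_sin b * fps_sin b = B * s * s"
    unfolding sin B_def power2_eq_square fps_const_mult[symmetric] by (simp only: mult_ac)
  \<comment> \<open>This removes the square of s' = cos(b z), so that derivatives of G(s) become
    operators on G with polynomial coefficients.\<close>
  ultimately have cos2: "fps_cos b * fps_cos b = 1 - B * s * s"
    by (simp add: eq_diff_eq)
  show d1: "fps_deriv (G oo s) = (fps_deriv G oo s) * fps_cos b" for G
    using fps_compose_deriv[OF s0] s' by simp
  have c': "fps_deriv (fps_cos b) = - (B * s)"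
    unfolding fps_cos_deriv sin B_def power2_eq_square fps_const_mult[symmetric] fps_const_neg[symmetric]
    by (simp only: mult_minus_left mult.assoc)
  note comp = fps_compose_mult_distrib[OF s0] fps_compose_sub_distrib fps_const_compose fps_X_fps_compose_startby0[OF s0]
  have d2: "fps_deriv (fps_deriv (G oo s)) = (1 - B * s * s) * (fps_deriv (fps_deriv G) oo s) - B * s * (fps_deriv G oo s)"
    unfolding d1 fps_deriv_mult c' cos2[symmetric] by (simp add: algebra_simps)
  then show "fps_deriv (fps_deriv (G oo s)) = ((1 - B * fps_X * fps_X) * fps_deriv (fps_deriv G) - B * fps_X * fps_deriv G) oo s"
    unfolding B_def by (simp add: comp)
  have "fps_deriv (fps_deriv (fps_cos b * (G oo s)))
     = fps_cos b * fps_deriv (fps_deriv (G oo s)) + 2 * fps_deriv (fps_cos b) * fps_deriv (G oo s)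
       + fps_deriv (fps_deriv (fps_cos b)) * (G oo s)"
    by (simp add: algebra_simps)
  also have "fps_deriv (fps_deriv (fps_cos b)) = - (B * fps_cos b)"
    unfolding c' by (simp add: B_def s')
  \<comment> \<open>The 3 is 1 from the second derivative of G(s) plus 2 from the mixed term of the
    product rule.\<close>
  also have "fps_cos b * fps_deriv (fps_deriv (G oo s)) + 2 * fps_deriv (fps_cos b) * fps_deriv (G oo s)
       + - (B * fps_cos b) * (G oo s)
     = fps_cos b * ((1 - B * s * s) * (fps_deriv (fps_deriv G) oo s) - 3 * B * s * (fps_deriv G oo s) - B * (G oo s))"
    unfolding d2 unfolding c' d1 by (simp add: algebra_simps)
  finally have "fps_deriv (fps_deriv (fps_cos b * (G oo s)))
     = fps_cos b * ((1 - B * s * s) * (fps_deriv (fps_deriv G) oo s) - 3 * B * s * (fps_deriv G oo s) - B * (G oo s))" .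
  moreover have "fps_const (3 * b\<^sup>2) = 3 * B"
    by (simp add: B_def numeral_fps_const)
  ultimately show "fps_deriv (fps_deriv (fps_cos b * (G oo s)))
      = fps_cos b * (((1 - B * fps_X * fps_X) * fps_deriv (fps_deriv G) - fps_const (3 * b\<^sup>2) * fps_X * fps_deriv G - B * G) oo s)"
    unfolding B_def comp fps_compose_1 by simp
qed

lemma mu_1_egf: "Abs_fps (\<lambda>m. if even m then mu (m div 2) a b 1 / fact m else 0) = fps_cos a / fps_cos b"
proof -
  define D where "D k h = of_nat (k choose h) * (\<Prod>i=h..<k. lam a b 1 (2 * i + 1))" for k h
  define M where "M n k = (jac_step (lam a b 1) ^^ n) (D k) 0" for n k
  \<comment> \<open>Collects the values L(y^n \<phi> k) in the variable w = sin(b z) / b;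
    \<open>Q n\<close> below is the same series in z.\<close>
  define G where "G n = Abs_fps (\<lambda>m. if even m then M n (m div 2) / fact m else 0)" for n
  define s where "s = fps_integral0 (fps_cos b)"
  define Q where "Q n = G n oo s" for n
  have M_rec: "M n (Suc k) = 4 * b\<^sup>2 * (of_nat k)\<^sup>2 * M n k + M (Suc n) k" for n k
  proof -
    have "M n (Suc k) = 4 * b\<^sup>2 * (of_nat k)\<^sup>2 * M n k + 1 * M (Suc n) k"
      unfolding M_def by (rule jac_step_iter_comb) (unfold D_def, rule jac_step_lam_1_product)
    then show ?thesis by simp
  qed
  have G_step: "of_nat (m + 1) * of_nat (m + 2) * fps_nth (G n) (m + 2) = (if even m then M n (Suc (m div 2)) / fact m else 0)" for n m
  proof -
    have "fact (m + 2) = of_nat (m + 1) * of_nat (m + 2) * (fact m :: complex)"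
      by (simp add: algebra_simps)
    moreover have "of_nat (m + 1) * of_nat (m + 2) \<noteq> (0::complex)"
      unfolding of_nat_mult[symmetric] of_nat_eq_0_iff by simp
    ultimately show ?thesis
      by (simp add: G_def del: fact_Suc of_nat_add)
  qed
  have G_rec: "G (Suc n) = (1 - fps_const (b\<^sup>2) * fps_X * fps_X) * fps_deriv (fps_deriv (G n)) - fps_const (b\<^sup>2) * fps_X * fps_deriv (G n)" for n
  proof (rule fps_ext)
    fix m
    show "fps_nth (G (Suc n)) m = fps_nth ((1 - fps_const (b\<^sup>2) * fps_X * fps_X) * fps_deriv (fps_deriv (G n)) - fps_const (b\<^sup>2) * fps_X * fps_deriv (G n)) m"
    proof (cases "even m")
      case True
      then obtain k where "m = 2 * k" by (rule evenE)
      then show ?thesis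
        unfolding fps_nth_second_order G_step
        by (simp add: G_def M_rec add_divide_distrib algebra_simps power2_eq_square)
    next
      case False
      then show ?thesis
        unfolding fps_nth_second_order G_step by (simp add: G_def)
    qed
  qed
  \<comment> \<open>Multiplication by y under L becomes a second derivative in z, so the Taylor
    coefficients of \<open>Q 0\<close> are the moments.\<close>
  have Q_deriv: "fps_deriv (fps_deriv (Q n)) = Q (Suc n)" for n
    unfolding Q_def s_def fps_deriv_compose_sin(2) G_rec ..
  have Q_nth: "fps_nth (Q n) m = (if even m then M (n + m div 2) 0 / fact m else 0)" for n m
  proof (induction m arbitrary: n rule: induct_nat_012)
    case 0
    show ?case by (simp add: Q_def G_def)
  next
    case 1
    have "fps_nth (fps_deriv (Q n)) 0 = 0"
      unfolding Q_def s_def fps_deriv_compose_sin(1) by (simp add: G_def)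
    then show ?case by simp
  next
    case (ge2 m)
    define c where "c = (of_nat (m + 1) * of_nat (m + 2) :: complex)"
    have "c * fps_nth (Q n) (Suc (Suc m)) = fps_nth (fps_deriv (fps_deriv (Q n))) m"
      by (simp add: c_def algebra_simps)
    also have "\<dots> = (if even m then M (Suc n + m div 2) 0 / fact m else 0)"
      unfolding Q_deriv by (rule ge2.IH(1))
    finally have eq: "c * fps_nth (Q n) (Suc (Suc m)) = \<dots>" .
    have "c \<noteq> 0"
      unfolding c_def of_nat_mult[symmetric] of_nat_eq_0_iff by simp
    then have "fps_nth (Q n) (Suc (Suc m)) = (if even m then M (Suc n + m div 2) 0 / fact m else 0) / c"
      using eq by (metis nonzero_mult_div_cancel_left)
    moreover have "fact (Suc (Suc m)) = fact m * c"
      by (simp add: c_def algebra_simps)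
    ultimately show ?case
      by (simp del: fact_Suc)
  qed
  have "D 0 = unit0" by (auto simp: D_def unit0_def)
  then have egf: "Abs_fps (\<lambda>m. if even m then mu (m div 2) a b 1 / fact m else 0) = Q 0"
    by (intro fps_ext) (simp add: Q_nth M_def mu_eq_moment)
  have "fps_cos a = fps_cos b * Q 0"
  proof (rule eq_fps_cos)
    show "fps_nth (fps_cos b * Q 0) 0 = 1"
      by (simp add: Q_nth M_def D_def)
    show "fps_nth (fps_cos b * Q 0) 1 = 0"
      by (simp add: fps_mult_nth Q_nth)
    have M0: "M 0 (Suc k) = (b\<^sup>2 * (2 * of_nat k + 1)\<^sup>2 - a\<^sup>2) * M 0 k" for k
      using lam_1(1)[of a b k] by (simp add: M_def D_def)
    \<comment> \<open>With m = 2k, m (m - 1) + 3 m + 1 = (m + 1)^2 cancels the b^2 part of the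
      weight in \<open>M0\<close>, leaving -a^2.\<close>
    have "(1 - fps_const (b\<^sup>2) * fps_X * fps_X) * fps_deriv (fps_deriv (G 0)) - fps_const (3 * b\<^sup>2) * fps_X * fps_deriv (G 0)
        - fps_const (b\<^sup>2) * G 0 = - fps_const (a\<^sup>2) * G 0"
    proof (rule fps_ext)
      fix m
      show "fps_nth ((1 - fps_const (b\<^sup>2) * fps_X * fps_X) * fps_deriv (fps_deriv (G 0)) - fps_const (3 * b\<^sup>2) * fps_X * fps_deriv (G 0)
          - fps_const (b\<^sup>2) * G 0) m = fps_nth (- fps_const (a\<^sup>2) * G 0) m"
        unfolding fps_sub_nth[of _ "fps_const (b\<^sup>2) * G 0"] fps_nth_second_order G_step
      proof (cases "even m")
        case True
        then obtain k where "m = 2 * k" by (rule evenE)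
        then show "(if even m then M 0 (Suc (m div 2)) / fact m else 0)
            - (b\<^sup>2 * of_nat m * (of_nat m - 1) + 3 * b\<^sup>2 * of_nat m) * fps_nth (G 0) m
            - fps_nth (fps_const (b\<^sup>2) * G 0) m = fps_nth (- fps_const (a\<^sup>2) * G 0) m"
          by (simp add: G_def M0 diff_divide_distrib add_divide_distrib algebra_simps power2_eq_square flip: fps_const_neg)
      next
        case False
        then show "(if even m then M 0 (Suc (m div 2)) / fact m else 0)
            - (b\<^sup>2 * of_nat m * (of_nat m - 1) + 3 * b\<^sup>2 * of_nat m) * fps_nth (G 0) m
            - fps_nth (fps_const (b\<^sup>2) * G 0) m = fps_nth (- fps_const (a\<^sup>2) * G 0) m"
          by (simp add: G_def)
      qed
    qed
    then have "fps_deriv (fps_deriv (fps_cos b * Q 0)) = fps_cos b * ((- fps_const (a\<^sup>2) * G 0) oo s)"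
      unfolding Q_def s_def fps_deriv_compose_sin(3) by simp
    also have "\<dots> = - (fps_const a * fps_const a * (fps_cos b * Q 0))"
      by (simp add: Q_def s_def fps_compose_mult_distrib fps_const_compose power2_eq_square mult_ac)
        (simp flip: fps_const_neg)
    finally show "fps_deriv (fps_deriv (fps_cos b * Q 0)) = - (fps_const a * fps_const a * (fps_cos b * Q 0))" .
  qed
  moreover have "fps_cos b \<noteq> 0"
    using fps_cos_nth_0[of b] by fastforce
  ultimately show ?thesis
    unfolding egf by (metis nonzero_mult_div_cancel_left)
qed

section \<open>Nonnegativity\<close>

text \<open>The point q = 0 is excluded because \<open>powr\<close> takes a dummy value
  there.\<close>

definition nonneg_poly_fun :: "(complex \<Rightarrow> complex) \<Rightarrow> bool" where
  "nonneg_poly_fun f \<longleftrightarrow> (\<exists>p :: real poly. (\<forall>i. coeff p i \<ge> 0) \<and>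
     (\<forall>q. q \<noteq> 0 \<longrightarrow> f q = poly (map_poly of_real p) q))"

lemma nonneg_poly_fun_const: "0 \<le> c \<Longrightarrow> nonneg_poly_fun (\<lambda>q. of_real c)"
  unfolding nonneg_poly_fun_def
  by (rule exI[of _ "[:c:]"]) (auto simp: coeff_pCons map_poly_pCons split: nat.split)

lemma nonneg_poly_fun_ident: "nonneg_poly_fun (\<lambda>q. q)"
  unfolding nonneg_poly_fun_def
  by (rule exI[of _ "[:0, 1:]"]) (auto simp: coeff_pCons map_poly_pCons split: nat.split)

lemma nonneg_poly_fun_add:
  assumes "nonneg_poly_fun f" "nonneg_poly_fun g"
  shows "nonneg_poly_fun (\<lambda>q. f q + g q)"
proof -
  obtain p r :: "real poly" where p: "\<forall>i. coeff p i \<ge> 0" "\<And>q. q \<noteq> 0 \<Longrightarrow> f q = poly (map_poly of_real p) q"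
    and r: "\<forall>i. coeff r i \<ge> 0" "\<And>q. q \<noteq> 0 \<Longrightarrow> g q = poly (map_poly of_real r) q"
    using assms unfolding nonneg_poly_fun_def by metis
  have "map_poly of_real (p + r) = map_poly of_real p + (map_poly of_real r :: complex poly)"
    by (rule poly_eqI) (simp add: coeff_map_poly)
  then show ?thesis
    unfolding nonneg_poly_fun_def using p r by (intro exI[of _ "p + r"]) simp
qed

lemma nonneg_poly_fun_mult:
  assumes "nonneg_poly_fun f" "nonneg_poly_fun g"
  shows "nonneg_poly_fun (\<lambda>q. f q * g q)"
proof -
  obtain p r :: "real poly" where p: "\<forall>i. coeff p i \<ge> 0" "\<And>q. q \<noteq> 0 \<Longrightarrow> f q = poly (map_poly of_real p) q"
    and r: "\<forall>i. coeff r i \<ge> 0" "\<And>q. q \<noteq> 0 \<Longrightarrow> g q = poly (map_poly of_real r) q"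
    using assms unfolding nonneg_poly_fun_def by metis
  have "map_poly of_real (p * r) = map_poly of_real p * (map_poly of_real r :: complex poly)"
    by (rule poly_eqI) (simp add: coeff_map_poly coeff_mult)
  moreover have "coeff (p * r) i \<ge> 0" for i
    using p(1) r(1) by (auto simp: coeff_mult intro!: sum_nonneg)
  ultimately show ?thesis
    unfolding nonneg_poly_fun_def using p(2) r(2) by (intro exI[of _ "p * r"]) simp
qed

lemma nonneg_poly_fun_cong:
  "(\<And>q. q \<noteq> 0 \<Longrightarrow> f q = g q) \<Longrightarrow> nonneg_poly_fun g \<Longrightarrow> nonneg_poly_fun f"
  unfolding nonneg_poly_fun_def by simp

lemma nonneg_poly_fun_qnum: "nonneg_poly_fun (\<lambda>q. qnum q (of_nat m))"
proof (induction m)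
  case 0
  show ?case
    by (rule nonneg_poly_fun_cong[OF _ nonneg_poly_fun_const[of 0]]) (simp_all add: qnum_def)
next
  case (Suc m)
  have "nonneg_poly_fun (\<lambda>q. of_real 1 + q * qnum q (of_nat m))"
    by (intro nonneg_poly_fun_add nonneg_poly_fun_mult nonneg_poly_fun_const nonneg_poly_fun_ident Suc.IH) simp
  moreover have "qnum q (of_nat (Suc m)) = of_real 1 + q * qnum q (of_nat m)" if "q \<noteq> 0" for q
    using that by (auto simp: qnum_def powr_add field_simps)
  ultimately show ?case by (rule nonneg_poly_fun_cong[rotated])
qed

lemma nonneg_poly_fun_lam:
  fixes a b :: real
  assumes ab: "a \<in> \<int> \<and> b \<in> \<int> \<or> a - 1 / 2 \<in> \<int> \<and> b - 1 / 2 \<in> \<int>" and "0 \<le> a" "a < b"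
  shows "nonneg_poly_fun (\<lambda>q. lam (of_real a) (of_real b) q m)"
proof -
  have qnum: "nonneg_poly_fun (\<lambda>q. qnum q (of_real x))" if x: "x \<in> \<int>" "0 \<le> x" for x :: real
  proof -
    obtain i :: int where i: "x = of_int i" using x(1) by (auto elim: Ints_cases)
    then have "x = of_nat (nat i)" using x(2) by simp
    then show ?thesis using nonneg_poly_fun_qnum[of "nat i"] by simp
  qed
  have "nonneg_poly_fun (\<lambda>q. qnum q (of_real (of_nat m * b + a)) * qnum q (of_real (of_nat m * b - a)))" if "odd m"
  proof -
    obtain t where t: "m = 2 * t + 1" using \<open>odd m\<close> by (rule oddE)
    \<comment> \<open>Shifting by 1/2 treats the half-integer case: for m = 2t + 1 the halves add up
      to t + 1 and t.\<close>
    have eq: "of_nat m * b + a = of_nat t + 1 + (of_nat m * (b - 1 / 2) + (a - 1 / 2))"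
      "of_nat m * b - a = of_nat t + (of_nat m * (b - 1 / 2) - (a - 1 / 2))"
      by (simp_all add: t algebra_simps)
    have half: "of_nat t + 1 + (of_nat m * y + x) \<in> \<int>" "of_nat t + (of_nat m * y - x) \<in> \<int>"
      if "x \<in> \<int>" "y \<in> \<int>" for x y :: real
      using that by simp_all
    have int: "of_nat m * b + a \<in> \<int>" "of_nat m * b - a \<in> \<int>"
      using ab half[of "a - 1 / 2" "b - 1 / 2"] unfolding eq[symmetric]
      by (auto intro: Ints_add Ints_diff Ints_mult)
    have "1 * b \<le> of_nat m * b"
      using t assms by (intro mult_right_mono) simp_all
    then have "0 \<le> of_nat m * b + a" "0 \<le> of_nat m * b - a"
      using assms(2,3) by linarith+
    with int show ?thesis
      by (intro nonneg_poly_fun_mult qnum)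
  qed
  moreover have "nonneg_poly_fun (\<lambda>q. (qnum q (of_real (of_nat m * b)))\<^sup>2)" if "even m"
  proof -
    obtain t where t: "m = 2 * t" using \<open>even m\<close> by (rule evenE)
    have eq: "of_nat m * b = of_nat t + of_nat m * (b - 1 / 2)"
      by (simp add: t algebra_simps)
    have half: "of_nat t + of_nat m * y \<in> \<int>" if "y \<in> \<int>" for y :: real
      using that by simp
    have int: "of_nat m * b \<in> \<int>"
      using ab half[of "b - 1 / 2"] unfolding eq[symmetric] by (auto intro: Ints_mult)
    have "0 \<le> of_nat m * b"
      using assms(2,3) by simp
    with int show ?thesis
      unfolding power2_eq_square by (intro nonneg_poly_fun_mult qnum)
  qed
  ultimately show ?thesis by (cases "even m") (simp_all add: lam_def)
qed

text \<open>The explicit formula has alternating signs, so positivity is read off the path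
  expansion, built from the weights by sums and products. The induction needs all heights, since
  \<open>jac_step\<close> couples neighbours.\<close>

lemma nonneg_poly_fun_mu:
  fixes a b :: real
  assumes "a \<in> \<int> \<and> b \<in> \<int> \<or> a - 1 / 2 \<in> \<int> \<and> b - 1 / 2 \<in> \<int>" and "0 \<le> a" "a < b"
  shows "nonneg_poly_fun (mu n (of_real a) (of_real b))"
proof -
  have "nonneg_poly_fun (\<lambda>q. (jac_step (lam (of_real a) (of_real b) q) ^^ n) unit0 h)" for h
  proof (induction n arbitrary: h)
    case 0
    show ?case using nonneg_poly_fun_const[of 1] nonneg_poly_fun_const[of 0] by (simp add: unit0_def)
  next
    case (Suc n)
    define u where "u q = (jac_step (lam (of_real a) (of_real b) q) ^^ n) unit0" for q
    have IH: "nonneg_poly_fun (\<lambda>q. u q h)" for h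
      unfolding u_def by (rule Suc.IH)
    have "nonneg_poly_fun (\<lambda>q. if h = 0 then 0 else u q (h - 1))"
      using IH nonneg_poly_fun_const[of 0] by (cases h) simp_all
    then have "nonneg_poly_fun (\<lambda>q. jac_step (lam (of_real a) (of_real b) q) (u q) h)"
      unfolding jac_step_def
      by (intro nonneg_poly_fun_add nonneg_poly_fun_mult nonneg_poly_fun_lam assms IH)
    then show ?case by (simp add: u_def)
  qed
  then show ?thesis
    by (rule nonneg_poly_fun_cong[rotated]) (rule mu_eq_moment)
qed

theorem theorem8p1:
  shows "(\<forall>(a::complex) (b::complex) (q::complex) (n::nat). q \<noteq> 0 \<longrightarrow> q \<noteq> 1 \<longrightarrow>
            mu n a b q =
              1 / (1 - q) ^ (2 * n) *
              (\<Sum>k=0..n. of_int (binom (2 * n) (int n - int k) - binom (2 * n) (int n - int k - 1)) *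
                (\<Sum>j=- int k..int k.
                   (-1) powi j *
                   q powr (a * of_int j + b * of_int (int k * (int k + 1) - j\<^sup>2)))))
       \<and> (\<forall>(a::complex) (b::complex).
            Abs_fps (\<lambda>m. if even m then mu (m div 2) a b 1 / fact m else 0)
              = fps_cos a / fps_cos b)
       \<and> (\<forall>(a::real) (b::real) (n::nat).
            (a \<in> \<int> \<and> b \<in> \<int> \<or> a - 1 / 2 \<in> \<int> \<and> b - 1 / 2 \<in> \<int>) \<longrightarrow> 0 \<le> a \<longrightarrow> a < b \<longrightarrow>
            (\<exists>p :: real poly. (\<forall>i. coeff p i \<ge> 0) \<and>
               (\<forall>q::complex. q \<noteq> 0 \<longrightarrow>
                  mu n (of_real a) (of_real b) q = poly (map_poly of_real p) q)))"
proof (intro conjI allI impI)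
  fix a b q :: complex and n :: nat
  assume "q \<noteq> 0" "q \<noteq> 1"
  then show "mu n a b q =
      1 / (1 - q) ^ (2 * n) *
      (\<Sum>k=0..n. of_int (binom (2 * n) (int n - int k) - binom (2 * n) (int n - int k - 1)) *
        (\<Sum>j=- int k..int k.
           (-1) powi j *
           q powr (a * of_int j + b * of_int (int k * (int k + 1) - j\<^sup>2))))"
    by (rule mu_formula)
next
  fix a b :: complex
  show "Abs_fps (\<lambda>m. if even m then mu (m div 2) a b 1 / fact m else 0) = fps_cos a / fps_cos b"
    by (rule mu_1_egf)
next
  fix a b :: real and n :: nat
  assume "a \<in> \<int> \<and> b \<in> \<int> \<or> a - 1 / 2 \<in> \<int> \<and> b - 1 / 2 \<in> \<int>" "0 \<le> a" "a < b"
  then show "\<exists>p :: real poly. (\<forall>i. coeff p i \<ge> 0) \<and>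
      (\<forall>q::complex. q \<noteq> 0 \<longrightarrow> mu n (of_real a) (of_real b) q = poly (map_poly of_real p) q)"
    using nonneg_poly_fun_mu unfolding nonneg_poly_fun_def by blast
qed

end
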